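(* Let $E$ be a split structure on $M$. The following are equivalent: 1) $E$ is a generalized almost product structure; 2) $T^*M=(T^*M\cap E)\oplus (T^*M\cap E^\perp)$; 3) $(\pi(E),\pi(E^\perp))$ is an almost product structure, i.e. $\pi(E)$ and $\pi(E^\perp)$ are subbundles of $TM$ and $TM=\pi(E)\oplus\pi(E^\perp)$; 4) there exists a $2$-form $B_E\in\Omega_M^2$ such that $\mathrm{Ad}_{B_E}(E)=\pi(E)\oplus \mathrm{Ann}(\pi(E^\perp))$ and $\mathrm{Ad}_{B_E}(E^\perp)=\pi(E^\perp)\oplus\mathrm{Ann}(\pi(E))$; 5) $[\mathrm{pr}_E(df),\mathrm{pr}_E(dg)]=0$ for all $f,g\in\Omega_M^0$.
   Context: $M$ is a connected finite-dimensional smooth manifold, $\Omega_M=\Gamma(\wedge^\bullet T^*M)$ with its standard grading $\Omega_M^k$, and $\mathbb{T}M=TM\oplus T^*M$ with projection $\pi:\mathbb{T}M\to TM$. Sections $x=X+\alpha$ of $\mathbb{T}M$ are identified with the operators $\iota_X+\alpha\wedge$ on $\Omega_M$, and $[\,,\,]$ is the graded commutator of operators ($[\varphi,\psi]=\varphi\psi-(-1)^{kl}\psi\varphi$ for $\varphi,\psi$ of degrees $k,l$); so for sections of $\mathbb{T}M$, $[X+\alpha,Y+\beta]=\alpha(Y)+\beta(X)\in\Omega_M^0$. The tautological pairing on $\mathbb{T}M$ is $\langle x,y\rangle=2[x,y]$. A split structure of rank $2r$ on $M$ is a subbundle $E\subseteq\mathbb{T}M$ of rank $2r$ on which $\langle\,,\,\rangle$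 is non-degenerate of signature $(r,r)$; $E^\perp$ is its orthogonal complement and $\mathrm{pr}_E:\mathbb{T}M\to E$ is the orthogonal projection. A generalized almost product structure is a split structure $E$ of some rank $2r$ such that $\pi|_E$ has rank exactly $r$ at every point of $M$. For $B\in\Omega_M^2$, $\mathrm{Ad}_B(\psi)=e^B\circ\psi\circ e^{-B}$ (with $B$ acting by left exterior multiplication), which restricts to an orthogonal bundle automorphism of $\mathbb{T}M$. $\mathrm{Ann}(F)\subseteq T^*M$ denotes the annihilator of $F\subseteq TM$. *)

theory Defs
  imports "HOL-Analysis.Analysis"
begin

section \<open>Smooth maps on open subsets of the model space\<close>

text \<open>On open subsets of a finite-dimensional space this is being of class \<open>C\<^sup>k\<close>:
  all directional derivatives of order at most \<open>k\<close> exist and are continuous.\<close>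

fun Ck_on :: "nat \<Rightarrow> 'a::real_normed_vector set \<Rightarrow> ('a \<Rightarrow> 'b::real_normed_vector) \<Rightarrow> bool" where
  "Ck_on 0 S f \<longleftrightarrow> continuous_on S f"
| "Ck_on (Suc k) S f \<longleftrightarrow>
     (\<forall>x\<in>S. f differentiable (at x)) \<and>
     (\<forall>v. Ck_on k S (\<lambda>x. frechet_derivative f (at x) v))"

definition smooth_on :: "'a::real_normed_vector set \<Rightarrow> ('a \<Rightarrow> 'b::real_normed_vector) \<Rightarrow> bool" where
  "smooth_on S f \<longleftrightarrow> (\<forall>k. Ck_on k S f)"

section \<open>Smooth manifolds\<close>

text \<open>A chart is a domain together with a coordinate map.  The manifold is the whole type
  \<^typ>\<open>'m\<close>.  The model space \<^typ>\<open>'e\<close> is a finite-dimensional inner product space rather than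
  a type of class \<^class>\<open>euclidean_space\<close>, because that class excludes dimension 0.\<close>

type_synonym ('m, 'e) chart = "'m set \<times> ('m \<Rightarrow> 'e)"

definition chart_inv :: "('m, 'e) chart \<Rightarrow> 'e \<Rightarrow> 'm" where
  "chart_inv c = inv_into (fst c) (snd c)"

definition smooth_manifold ::
  "('m::{t2_space, second_countable_topology}, 'e::real_inner) chart set \<Rightarrow> bool" where
  "smooth_manifold A \<longleftrightarrow>
     (\<exists>B::'e set. finite B \<and> span B = UNIV) \<and>
     (\<Union>c\<in>A. fst c) = UNIV \<and>
     (\<forall>c\<in>A. open (fst c) \<and> open (snd c ` fst c) \<and>
        homeomorphism (fst c) (snd c ` fst c) (snd c) (chart_inv c)) \<and>
     (\<forall>c\<in>A. \<forall>d\<in>A. smooth_on (snd c ` (fst c \<inter> fst d)) (snd d \<circ> chart_inv c))"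

section \<open>Tangent and cotangent spaces\<close>

text \<open>The tangent space at every point \<open>p\<close> is the model space \<^typ>\<open>'e\<close>, a tangent vector being
  represented by its components in the chart \<open>chart_at A p\<close> selected at \<open>p\<close>.  Its components
  in any other chart \<open>c\<close> around \<open>p\<close> are obtained by the usual transformation law, i.e. by the
  derivative of the change of coordinates (\<open>to_coords A c p\<close>, the differential of \<open>c\<close> at \<open>p\<close>;
  its inverse is \<open>from_coords A c p\<close>).  As the selected chart may jump from point to point,
  smoothness of a section is always tested on its components in the charts of the atlas.\<close>

definition chart_at :: "('m, 'e) chart set \<Rightarrow> 'm \<Rightarrow> ('m, 'e) chart" where
  "chart_at A p = (SOME c. c \<in> A \<and> p \<in> fst c)"

definition to_coords ::
  "('m, 'e::real_inner) chart set \<Rightarrow> ('m, 'e) chart \<Rightarrow> 'm \<Rightarrow> 'e \<Rightarrow> 'e" where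
  "to_coords A c p =
     frechet_derivative (snd c \<circ> chart_inv (chart_at A p)) (at (snd (chart_at A p) p))"

definition from_coords ::
  "('m, 'e::real_inner) chart set \<Rightarrow> ('m, 'e) chart \<Rightarrow> 'm \<Rightarrow> 'e \<Rightarrow> 'e" where
  "from_coords A c p = frechet_derivative (snd (chart_at A p) \<circ> chart_inv c) (at (snd c p))"

type_synonym 'e covector = "'e \<Rightarrow>\<^sub>L real"

text \<open>Elements of the generalized tangent space: \<open>(X, \<alpha>)\<close> stands for \<open>X + \<alpha>\<close>, so the
  projection \<open>\<pi>\<close> to the tangent bundle is \<^const>\<open>fst\<close>.\<close>

type_synonym 'e gvector = "'e \<times> 'e covector"

definition smooth_function :: "('m, 'e::real_inner) chart set \<Rightarrow> ('m \<Rightarrow> real) \<Rightarrow> bool" where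
  "smooth_function A f \<longleftrightarrow> (\<forall>c\<in>A. smooth_on (snd c ` fst c) (f \<circ> chart_inv c))"

definition smooth_vector_field_on ::
  "('m, 'e::real_inner) chart set \<Rightarrow> 'm set \<Rightarrow> ('m \<Rightarrow> 'e) \<Rightarrow> bool" where
  "smooth_vector_field_on A W X \<longleftrightarrow>
     (\<forall>c\<in>A. smooth_on (snd c ` (fst c \<inter> W))
        (\<lambda>y. to_coords A c (chart_inv c y) (X (chart_inv c y))))"

definition smooth_covector_field_on ::
  "('m, 'e::real_inner) chart set \<Rightarrow> 'm set \<Rightarrow> ('m \<Rightarrow> 'e covector) \<Rightarrow> bool" where
  "smooth_covector_field_on A W \<alpha> \<longleftrightarrow>
     (\<forall>c\<in>A. \<forall>w. smooth_on (snd c ` (fst c \<inter> W))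
        (\<lambda>y. blinfun_apply (\<alpha> (chart_inv c y)) (from_coords A c (chart_inv c y) w)))"

definition smooth_gsection_on ::
  "('m, 'e::real_inner) chart set \<Rightarrow> 'm set \<Rightarrow> ('m \<Rightarrow> 'e gvector) \<Rightarrow> bool" where
  "smooth_gsection_on A W s \<longleftrightarrow>
     smooth_vector_field_on A W (\<lambda>p. fst (s p)) \<and>
     smooth_covector_field_on A W (\<lambda>p. snd (s p))"

definition differential ::
  "('m, 'e::real_inner) chart set \<Rightarrow> ('m \<Rightarrow> real) \<Rightarrow> 'm \<Rightarrow> 'e covector" where
  "differential A f p =
     Blinfun (frechet_derivative (f \<circ> chart_inv (chart_at A p)) (at (snd (chart_at A p) p)))"

section \<open>Subbundles\<close>

text \<open>Rank-\<open>k\<close> subbundles, given by local smooth frames.  The argument \<open>smooth_sec\<close> is the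
  predicate of smooth local sections of the ambient bundle.\<close>

definition subbundle_of_rank ::
  "('m::topological_space set \<Rightarrow> ('m \<Rightarrow> 'v::real_vector) \<Rightarrow> bool) \<Rightarrow> nat \<Rightarrow> ('m \<Rightarrow> 'v set) \<Rightarrow> bool" where
  "subbundle_of_rank smooth_sec k F \<longleftrightarrow>
     (\<forall>p. \<exists>W s. open W \<and> p \<in> W \<and>
        (\<forall>i<k. smooth_sec W (s i)) \<and>
        (\<forall>q\<in>W. inj_on (\<lambda>i. s i q) {..<k} \<and>
               independent ((\<lambda>i. s i q) ` {..<k}) \<and>
               span ((\<lambda>i. s i q) ` {..<k}) = F q))"

definition tangent_subbundle ::
  "('m::topological_space, 'e::real_inner) chart set \<Rightarrow> ('m \<Rightarrow> 'e set) \<Rightarrow> bool" where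
  "tangent_subbundle A F \<longleftrightarrow> (\<exists>k. subbundle_of_rank (smooth_vector_field_on A) k F)"

definition direct_sum_decomposition ::
  "'v::real_vector set \<Rightarrow> 'v set \<Rightarrow> 'v set \<Rightarrow> bool" where
  "direct_sum_decomposition V P N \<longleftrightarrow>
     subspace P \<and> subspace N \<and> P \<inter> N = {0} \<and> V = {x + y | x y. x \<in> P \<and> y \<in> N}"

definition almost_product_structure ::
  "('m::topological_space, 'e::real_inner) chart set \<Rightarrow> ('m \<Rightarrow> 'e set) \<Rightarrow> ('m \<Rightarrow> 'e set) \<Rightarrow> bool" where
  "almost_product_structure A F G \<longleftrightarrow>
     tangent_subbundle A F \<and> tangent_subbundle A G \<and>
     (\<forall>p. direct_sum_decomposition UNIV (F p) (G p))"

definition annihilator :: "'e::real_inner set \<Rightarrow> 'e covector set" where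
  "annihilator F = {\<alpha>. \<forall>v\<in>F. blinfun_apply \<alpha> v = 0}"

section \<open>Exterior algebra and operators on forms\<close>

text \<open>A possibly inhomogeneous form at a point is a function on lists of tangent vectors; its
  degree-\<open>k\<close> part is the restriction to lists of length \<open>k\<close>.  In finite dimension, alternation
  makes all parts of degree above the dimension vanish.\<close>

type_synonym 'e form = "'e list \<Rightarrow> real"

definition forms :: "'e::real_vector form set" where
  "forms = {\<omega>. (\<forall>us vs. linear (\<lambda>v. \<omega> (us @ v # vs))) \<and>
               (\<forall>us vs ws v. \<omega> (us @ v # vs @ v # ws) = 0)}"

definition forms_of_degree :: "nat \<Rightarrow> 'e::real_vector form set" where
  "forms_of_degree k = {\<omega> \<in> forms. \<forall>vs. length vs \<noteq> k \<longrightarrow> \<omega> vs = 0}"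

definition interior_product :: "'e \<Rightarrow> 'e form \<Rightarrow> 'e form" where
  "interior_product X \<omega> = (\<lambda>vs. \<omega> (X # vs))"

definition parity :: "'e form \<Rightarrow> 'e form" where
  "parity \<omega> = (\<lambda>vs. (-1) ^ length vs * \<omega> vs)"

text \<open>The exterior product (as a signed sum over shuffles, without normalizing factor), by
  recursion on the arguments:
  \<open>\<iota>\<^sub>X (\<omega> \<and> \<eta>) = \<iota>\<^sub>X \<omega> \<and> \<eta> + (-1)\<^bsup>deg \<omega>\<^esup> \<omega> \<and> \<iota>\<^sub>X \<eta>\<close>.\<close>

fun wedge :: "'e form \<Rightarrow> 'e form \<Rightarrow> 'e form" where
  "wedge \<omega> \<eta> [] = \<omega> [] * \<eta> []"
| "wedge \<omega> \<eta> (X # vs) =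
     wedge (interior_product X \<omega>) \<eta> vs + wedge (parity \<omega>) (interior_product X \<eta>) vs"

definition one_form :: "'e::real_normed_vector covector \<Rightarrow> 'e form" where
  "one_form \<alpha> = (\<lambda>vs. case vs of [v] \<Rightarrow> blinfun_apply \<alpha> v | _ \<Rightarrow> 0)"

text \<open>The operator \<open>\<iota>\<^sub>X + \<alpha>\<and>\<close>.\<close>

definition gvector_op :: "'e::real_normed_vector gvector \<Rightarrow> 'e form \<Rightarrow> 'e form" where
  "gvector_op x \<omega> = (\<lambda>vs. interior_product (fst x) \<omega> vs + wedge (one_form (snd x)) \<omega> vs)"

text \<open>Left exterior multiplication by \<open>e\<^sup>B\<close>.  The series is a finite sum if \<open>B\<close> is a 2-form.\<close>

definition exp_op :: "'e form \<Rightarrow> 'e form \<Rightarrow> 'e form" where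
  "exp_op B \<omega> = (\<lambda>vs. \<Sum>k. ((wedge B ^^ k) \<omega>) vs / fact k)"

definition Ad_op :: "'e form \<Rightarrow> ('e form \<Rightarrow> 'e form) \<Rightarrow> 'e form \<Rightarrow> 'e form" where
  "Ad_op B \<psi> = exp_op B \<circ> \<psi> \<circ> exp_op (\<lambda>vs. - B vs)"

definition Ad_image :: "'e::real_normed_vector form \<Rightarrow> 'e gvector set \<Rightarrow> 'e gvector set" where
  "Ad_image B S = {x. \<exists>y\<in>S. \<forall>\<omega>\<in>forms. gvector_op x \<omega> = Ad_op B (gvector_op y) \<omega>}"

definition smooth_form_of_degree ::
  "('m, 'e::real_inner) chart set \<Rightarrow> nat \<Rightarrow> ('m \<Rightarrow> 'e form) \<Rightarrow> bool" where
  "smooth_form_of_degree A k \<omega> \<longleftrightarrow>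
     (\<forall>p. \<omega> p \<in> forms_of_degree k) \<and>
     (\<forall>c\<in>A. \<forall>ws. smooth_on (snd c ` fst c)
        (\<lambda>y. \<omega> (chart_inv c y) (map (from_coords A c (chart_inv c y)) ws)))"

section \<open>Split structures\<close>

text \<open>The graded commutator \<open>[x, y]\<close> of two elements of the generalized tangent space, which is
  multiplication by the following number (see \<open>gvector_op_commutator\<close> below).\<close>

definition gbracket :: "'e::real_normed_vector gvector \<Rightarrow> 'e gvector \<Rightarrow> real" where
  "gbracket x y = blinfun_apply (snd x) (fst y) + blinfun_apply (snd y) (fst x)"

lemma wedge_zero_left: "(\<And>vs. \<zeta> vs = 0) \<Longrightarrow> wedge \<zeta> \<omega> vs = 0"
  by (induction vs arbitrary: \<zeta> \<omega>) (auto simp: interior_product_def parity_def)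

lemma wedge_function_left:
  "(\<And>vs. vs \<noteq> [] \<Longrightarrow> \<zeta> vs = 0) \<Longrightarrow> wedge \<zeta> \<omega> vs = \<zeta> [] * \<omega> vs"
  by (induction vs arbitrary: \<zeta> \<omega>)
     (auto simp: interior_product_def parity_def wedge_zero_left)

lemma wedge_add_right: "wedge \<zeta> (\<lambda>vs. \<omega> vs + \<eta> vs) vs = wedge \<zeta> \<omega> vs + wedge \<zeta> \<eta> vs"
  by (induction vs arbitrary: \<zeta> \<omega> \<eta>) (auto simp: interior_product_def algebra_simps)

lemma wedge_scale_right: "wedge \<zeta> (\<lambda>vs. c * \<omega> vs) vs = c * wedge \<zeta> \<omega> vs"
  by (induction vs arbitrary: \<zeta> \<omega>) (auto simp: interior_product_def algebra_simps)

lemma wedge_minus_left: "wedge (\<lambda>vs. - \<zeta> vs) \<omega> vs = - wedge \<zeta> \<omega> vs"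
proof (induction vs arbitrary: \<zeta> \<omega>)
  case (Cons X vs)
  have "parity (\<lambda>vs. - \<zeta> vs) = (\<lambda>vs. - parity \<zeta> vs)"
    by (simp add: parity_def fun_eq_iff)
  with Cons show ?case by (simp add: interior_product_def)
qed simp

lemma parity_one_form: "parity (one_form \<alpha>) = (\<lambda>vs. - one_form \<alpha> vs)"
  by (auto simp: parity_def one_form_def fun_eq_iff split: list.split)

lemma wedge_one_form_Cons:
  "wedge (one_form \<alpha>) \<omega> (X # vs) =
     blinfun_apply \<alpha> X * \<omega> vs - wedge (one_form \<alpha>) (interior_product X \<omega>) vs"
proof -
  have "wedge (interior_product X (one_form \<alpha>)) \<omega> vs = blinfun_apply \<alpha> X * \<omega> vs"
    by (subst wedge_function_left) (auto simp: interior_product_def one_form_def split: list.split)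
  then show ?thesis by (simp add: parity_one_form wedge_minus_left)
qed

lemma wedge_one_form_anticommute:
  "wedge (one_form \<alpha>) (wedge (one_form \<beta>) \<omega>) vs
     + wedge (one_form \<beta>) (wedge (one_form \<alpha>) \<omega>) vs = 0"
proof (induction vs arbitrary: \<omega>)
  case Nil
  then show ?case by (simp add: one_form_def)
next
  case (Cons X vs)
  have *: "interior_product X (wedge (one_form \<gamma>) \<omega>) =
      (\<lambda>vs. blinfun_apply \<gamma> X * \<omega> vs + (- 1) * wedge (one_form \<gamma>) (interior_product X \<omega>) vs)"
    for \<gamma>
    by (rule ext)
      (simp add: interior_product_def[of X "wedge (one_form \<gamma>) \<omega>"] wedge_one_form_Cons del: wedge.simps)
  have "wedge (one_form \<gamma>) (wedge (one_form \<delta>) \<omega>) (X # vs) =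
      blinfun_apply \<gamma> X * wedge (one_form \<delta>) \<omega> vs
      - blinfun_apply \<delta> X * wedge (one_form \<gamma>) \<omega> vs
      + wedge (one_form \<gamma>) (wedge (one_form \<delta>) (interior_product X \<omega>)) vs" for \<gamma> \<delta>
    unfolding wedge_one_form_Cons * wedge_add_right wedge_scale_right by simp
  with Cons[of "interior_product X \<omega>"] show ?case by simp
qed

lemma gvector_op_commutator:
  assumes "\<omega> \<in> forms"
  shows "gvector_op x (gvector_op y \<omega>) vs + gvector_op y (gvector_op x \<omega>) vs = gbracket x y * \<omega> vs"
proof -
  have alt: "\<omega> (X # Y # vs) + \<omega> (Y # X # vs) = 0" for X Y vs
  proof -
    have lin: "linear (\<lambda>v. \<omega> (us @ v # vs))" and nul: "\<omega> (us @ v # vs @ v # ws) = 0"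
      for us vs ws v using assms by (auto simp: forms_def)
    have "\<omega> ((X + Y) # (X + Y) # vs) = 0" "\<omega> (X # X # vs) = 0" "\<omega> (Y # Y # vs) = 0"
      using nul[of "[]" _ "[]" vs] by simp_all
    moreover have "\<omega> ((X + Y) # Z # vs) = \<omega> (X # Z # vs) + \<omega> (Y # Z # vs)" for Z
      using linear_add[OF lin[of "[]" "Z # vs"], of X Y] by simp
    moreover have "\<omega> (Z # (X + Y) # vs) = \<omega> (Z # X # vs) + \<omega> (Z # Y # vs)" for Z
      using linear_add[OF lin[of "[Z]" vs], of X Y] by simp
    ultimately show ?thesis by simp
  qed
  show ?thesis
    unfolding gvector_op_def interior_product_def[of _ "\<lambda>vs. _ vs + _ vs"] wedge_add_right
      wedge_one_form_Cons gbracket_def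
    using alt[of "fst x" "fst y" vs] wedge_one_form_anticommute[of "snd x" "snd y" \<omega> vs]
    by (simp add: interior_product_def[of _ \<omega>] algebra_simps)
qed

definition pairing :: "'e::real_normed_vector gvector \<Rightarrow> 'e gvector \<Rightarrow> real" where
  "pairing x y = 2 * gbracket x y"

definition nondegenerate_on :: "('v \<Rightarrow> 'v \<Rightarrow> real) \<Rightarrow> 'v::real_vector set \<Rightarrow> bool" where
  "nondegenerate_on b V \<longleftrightarrow> (\<forall>x\<in>V. (\<forall>y\<in>V. b x y = 0) \<longrightarrow> x = 0)"

definition has_signature :: "('v \<Rightarrow> 'v \<Rightarrow> real) \<Rightarrow> 'v::real_vector set \<Rightarrow> nat \<Rightarrow> nat \<Rightarrow> bool" where
  "has_signature b V r s \<longleftrightarrow>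
     (\<exists>P N. direct_sum_decomposition V P N \<and> dim P = r \<and> dim N = s \<and>
        (\<forall>x\<in>P. x \<noteq> 0 \<longrightarrow> b x x > 0) \<and> (\<forall>x\<in>N. x \<noteq> 0 \<longrightarrow> b x x < 0) \<and>
        (\<forall>x\<in>P. \<forall>y\<in>N. b x y = 0))"

definition split_structure ::
  "('m::topological_space, 'e::real_inner) chart set \<Rightarrow> nat \<Rightarrow> ('m \<Rightarrow> 'e gvector set) \<Rightarrow> bool" where
  "split_structure A r E \<longleftrightarrow>
     subbundle_of_rank (smooth_gsection_on A) (2 * r) E \<and>
     (\<forall>p. nondegenerate_on pairing (E p) \<and> has_signature pairing (E p) r r)"

definition generalized_almost_product_structure ::
  "('m::topological_space, 'e::real_inner) chart set \<Rightarrow> ('m \<Rightarrow> 'e gvector set) \<Rightarrow> bool" where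
  "generalized_almost_product_structure A E \<longleftrightarrow>
     (\<exists>r. split_structure A r E \<and> (\<forall>p. dim (fst ` E p) = r))"

definition orth :: "('m \<Rightarrow> 'e::real_normed_vector gvector set) \<Rightarrow> 'm \<Rightarrow> 'e gvector set" where
  "orth E p = {y. \<forall>x\<in>E p. pairing x y = 0}"

definition pr :: "('m \<Rightarrow> 'e::real_normed_vector gvector set) \<Rightarrow> 'm \<Rightarrow> 'e gvector \<Rightarrow> 'e gvector" where
  "pr E p x = (THE e. e \<in> E p \<and> x - e \<in> orth E p)"

definition cotangent :: "'e::real_normed_vector gvector set" where
  "cotangent = {0} \<times> UNIV"

end

(* Let P be the orthogonal projection onto E. Each of the five conditions says, pointwise, that P
   maps the cotangent space T' into itself, equivalently that the images F of E and G of its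
   orthogonal complement in TM meet only in 0.

   For 1), the covectors dual (by a scalar product) to F are mapped bijectively onto P(T'), so
   dim P(T') = dim F; as P(T') contains the kernel of E -> F, which has dimension 2r - dim F, it
   equals this kernel iff dim F = r. For 5), use that differentials of smooth functions exhaust T',
   by bump functions. For 4), write P(u, 0) = (X_u, xi_u); then B(u, v) = xi_u(v - 2 X_v) is
   alternating because P(u, 0) and (u, 0) - P(u, 0) are orthogonal, and Ad_B maps (Y, beta) to
   (Y, beta - i_Y B). For 3), F and G are spanned by the vectors X_w and w - X_w for w in a
   coordinate frame and have constant rank. Smoothness of P is read off from its formula in a local
   frame of E, which involves the inverse of the Gram matrix. *)

theory Submission
  imports Defs "Jordan_Normal_Form.Determinant"
begin

section \<open>Calculus of smooth maps\<close>

text \<open>The criterion F Int G = 0 rests on two identities: the covectors in E form Ann(G), and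
  those in the complement of E form Ann(F). If P maps T' into itself, each covector is a sum of one
  that kills G and one that kills F, so every covector kills F Int G. Conversely, the vector part of
  P(0, \<alpha>) lies in F and, being opposite to that of (0, \<alpha>) - P(0, \<alpha>), also in G.
  The 2 in B does two things. Orthogonality of P(u, 0) and (u, 0) - P(u, 0) reads \<xi>_u(u - X_u) -
  \<xi>_u(X_u) = 0, which is B(u, u) = 0. And once F + G is direct, v - 2 X_v is the reflection that
  is -1 on F and 1 on G: the elements of E over u have covector part \<xi>_u up to Ann(G), those of
  the complement -\<xi>_u up to Ann(F), and the reflection supplies this sign. The formula makes
  sense for every split structure, so B inherits smoothness directly from P. Tangent vectors are
  stored in a chart chosen point by point, and this choice may jump. Smoothness and openness are
  therefore always argued with components in a fixed chart.\<close>

lemma Ck_on_Suc_D: "Ck_on (Suc k) S f \<Longrightarrow> Ck_on k S f"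
proof (induction k arbitrary: f)
  case 0
  then show ?case
    by (auto intro!: continuous_at_imp_continuous_on differentiable_imp_continuous_within)
next
  case (Suc k)
  have "Ck_on k S (\<lambda>x. frechet_derivative f (at x) v)" for v
    using Suc.prems by (intro Suc.IH) (simp del: Ck_on.simps(1) add: Ck_on.simps(2)[of "Suc k"])
  then show ?case using Suc.prems by simp
qed

text \<open>\<open>frechet_derivative\<close> chooses some derivative, so two functions with the
  same set of derivatives at a point get literally the same choice, even if that set is
  empty.\<close>

lemma frechet_derivative_cong_open:
  assumes "open S" "x \<in> S" "\<And>y. y \<in> S \<Longrightarrow> f y = g y"
  shows "frechet_derivative f (at x) = frechet_derivative g (at x)"
    and "f differentiable (at x) \<longleftrightarrow> g differentiable (at x)"
proof -
  have *: "(f has_derivative D) (at x) \<longleftrightarrow> (g has_derivative D) (at x)" for D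
    using has_derivative_transform_within_open[OF _ assms(1,2)] assms(3) by metis
  show "frechet_derivative f (at x) = frechet_derivative g (at x)"
    by (simp add: frechet_derivative_def *)
  show "f differentiable (at x) \<longleftrightarrow> g differentiable (at x)"
    by (simp add: differentiable_def *)
qed

lemma Ck_on_cong:
  assumes "open S" "\<And>y. y \<in> S \<Longrightarrow> f y = g y" "Ck_on k S f"
  shows "Ck_on k S g"
  using assms(2,3)
proof (induction k arbitrary: f g)
  case 0
  then show ?case using continuous_on_cong[of S S f g] by auto
next
  case (Suc k)
  have D: "frechet_derivative f (at x) = frechet_derivative g (at x)"
      "f differentiable (at x) \<longleftrightarrow> g differentiable (at x)" if "x \<in> S" for x
    by (rule frechet_derivative_cong_open[OF assms(1) that]; rule Suc.prems(1); assumption)+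
  have "Ck_on k S (\<lambda>x. frechet_derivative g (at x) v)" for v
  proof (rule Suc.IH)
    show "frechet_derivative f (at x) v = frechet_derivative g (at x) v" if "x \<in> S" for x
      by (rule fun_cong[OF D(1)[OF that]])
    show "Ck_on k S (\<lambda>x. frechet_derivative f (at x) v)" using Suc.prems(2) by simp
  qed
  moreover have "g differentiable (at x)" if "x \<in> S" for x
    using D(2)[OF that] Suc.prems(2) that by simp
  ultimately show ?case by simp
qed

text \<open>Lets an explicit formula D stand for \<open>frechet_derivative\<close>. As the recursion
  differentiates that formula again, agreement on an open set is what makes the exchange
  legitimate.\<close>

lemma Ck_on_SucI:
  assumes "open S" "\<And>x. x \<in> S \<Longrightarrow> (f has_derivative D x) (at x)" "\<And>v. Ck_on k S (\<lambda>x. D x v)"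
  shows "Ck_on (Suc k) S f"
proof -
  have "Ck_on k S (\<lambda>x. frechet_derivative f (at x) v)" for v
  proof (rule Ck_on_cong[OF assms(1) _ assms(3)])
    show "D x v = frechet_derivative f (at x) v" if "x \<in> S" for x
      by (rule fun_cong[OF frechet_derivative_at[OF assms(2)[OF that]]])
  qed
  moreover have "f differentiable (at x)" if "x \<in> S" for x
    using assms(2)[OF that] unfolding differentiable_def by blast
  ultimately show ?thesis by simp
qed

lemma Ck_on_has_derivative:
  "Ck_on (Suc k) S f \<Longrightarrow> x \<in> S \<Longrightarrow> (f has_derivative frechet_derivative f (at x)) (at x)"
  by (simp add: frechet_derivative_works)

lemma Ck_on_frechet_derivative:
  "Ck_on (Suc k) S f \<Longrightarrow> Ck_on k S (\<lambda>x. frechet_derivative f (at x) v)"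
  by simp

lemma Ck_on_local:
  assumes "\<And>x. x \<in> S \<Longrightarrow> \<exists>U. open U \<and> x \<in> U \<and> Ck_on k U f"
  shows "Ck_on k S f"
  using assms
proof (induction k arbitrary: f)
  case 0
  show ?case unfolding Ck_on.simps
  proof (rule continuous_at_imp_continuous_on, rule ballI)
    fix x assume "x \<in> S"
    then obtain U where "open U" "x \<in> U" "Ck_on 0 U f" using "0.prems" by blast
    then show "isCont f x" by (auto simp: continuous_on_eq_continuous_at)
  qed
next
  case (Suc k)
  have "\<exists>U. open U \<and> x \<in> U \<and> Ck_on k U (\<lambda>x. frechet_derivative f (at x) v)" if "x \<in> S" for x v
    using Suc.prems[OF that] by auto
  moreover have "f differentiable (at x)" if "x \<in> S" for x
    using Suc.prems[OF that] by auto
  ultimately show ?case using Suc.IH by simp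
qed

lemma Ck_on_subset: "Ck_on k S f \<Longrightarrow> T \<subseteq> S \<Longrightarrow> Ck_on k T f"
  by (induction k arbitrary: f) (auto intro: continuous_on_subset)

lemma Ck_on_const [simp]: "Ck_on k S (\<lambda>x. c)"
  by (induction k arbitrary: c) (auto)

lemma Ck_on_add:
  assumes "open S" "Ck_on k S f" "Ck_on k S g"
  shows "Ck_on k S (\<lambda>x. f x + g x)"
  using assms(2,3)
proof (induction k arbitrary: f g)
  case (Suc k)
  note D = Suc.prems[THEN Ck_on_has_derivative] and F = Suc.prems[THEN Ck_on_frechet_derivative]
  show ?case
    by (rule Ck_on_SucI[OF assms(1) has_derivative_add[OF D] Suc.IH[OF F]])
qed (auto intro: continuous_on_add)

lemma Ck_on_sum:
  assumes "open S" "\<And>i. i \<in> I \<Longrightarrow> Ck_on k S (f i)"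
  shows "Ck_on k S (\<lambda>x. \<Sum>i\<in>I. f i x)"
  using assms(2)
  by (induction I rule: infinite_finite_induct) (auto intro!: Ck_on_add assms(1))

text \<open>Each term of the product rule pairs one derivative with one undifferentiated factor,
  whose order is lowered by \<open>Ck_on_Suc_D\<close>; hence the induction over both
  functions.\<close>

lemma Ck_on_scaleR:
  fixes f :: "'a::real_normed_vector \<Rightarrow> real"
  assumes "open S" "Ck_on k S f" "Ck_on k S g"
  shows "Ck_on k S (\<lambda>x. f x *\<^sub>R g x)"
  using assms(2,3)
proof (induction k arbitrary: f g)
  case (Suc k)
  note D = Suc.prems[THEN Ck_on_has_derivative] and F = Suc.prems[THEN Ck_on_frechet_derivative]
    and C = Suc.prems[THEN Ck_on_Suc_D]
  show ?case
    by (rule Ck_on_SucI[OF assms(1) has_derivative_scaleR[OF D]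
          Ck_on_add[OF assms(1) Suc.IH[OF C(1) F(2)] Suc.IH[OF F(1) C(2)]]])
qed (auto intro: continuous_on_scaleR)

lemma Ck_on_linear:
  assumes "bounded_linear h" "open S" "Ck_on k S f"
  shows "Ck_on k S (\<lambda>x. h (f x))"
  using assms(3)
proof (induction k arbitrary: f)
  case 0
  then show ?case using bounded_linear.continuous_on[OF assms(1)] by simp
next
  case (Suc k)
  note D = Suc.prems[THEN Ck_on_has_derivative] and F = Suc.prems[THEN Ck_on_frechet_derivative]
  show ?case
    by (rule Ck_on_SucI[OF assms(2) bounded_linear.has_derivative[OF assms(1) D] Suc.IH[OF F]])
qed

text \<open>The derivative of 1/f is built from 1/f and Df, so 1/f itself, one order lower, serves
  as induction hypothesis.\<close>

lemma Ck_on_inverse: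
  fixes f :: "'a::real_normed_vector \<Rightarrow> real"
  assumes "open S" "\<And>x. x \<in> S \<Longrightarrow> f x \<noteq> 0" "Ck_on k S f"
  shows "Ck_on k S (\<lambda>x. inverse (f x))"
  using assms(3)
proof (induction k)
  case (Suc k)
  note D = Suc.prems[THEN Ck_on_has_derivative] and F = Suc.prems[THEN Ck_on_frechet_derivative]
  have I: "Ck_on k S (\<lambda>x. inverse (f x))" by (rule Suc.IH[OF Ck_on_Suc_D[OF Suc.prems]])
  show ?case
  proof (rule Ck_on_SucI[OF assms(1)])
    show "((\<lambda>x. inverse (f x)) has_derivative
      (\<lambda>v. (-1) *\<^sub>R (inverse (f x) *\<^sub>R (inverse (f x) *\<^sub>R frechet_derivative f (at x) v)))) (at x)"
      if "x \<in> S" for x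
      using Deriv.has_derivative_inverse[OF assms(2)[OF that] D[OF that]]
      by (simp add: mult.commute mult.left_commute)
    show "Ck_on k S (\<lambda>x. (-1) *\<^sub>R (inverse (f x) *\<^sub>R (inverse (f x) *\<^sub>R frechet_derivative f (at x) v)))"
      for v by (intro Ck_on_scaleR assms(1) I F Ck_on_const)
  qed
qed (use assms(2) in \<open>auto intro: continuous_on_inverse\<close>)

lemma Ck_on_id: "Ck_on k S (\<lambda>x. x)"
  by (cases k) auto

lemma smooth_on_const [simp]: "smooth_on S (\<lambda>x. c)"
  by (simp add: smooth_on_def)

lemma smooth_on_id: "smooth_on S (\<lambda>x. x)"
  by (simp add: smooth_on_def Ck_on_id)

lemma smooth_on_cong:
  "open S \<Longrightarrow> (\<And>y. y \<in> S \<Longrightarrow> f y = g y) \<Longrightarrow> smooth_on S f \<Longrightarrow> smooth_on S g"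
  unfolding smooth_on_def using Ck_on_cong by blast

lemma smooth_on_local:
  "(\<And>x. x \<in> S \<Longrightarrow> \<exists>U. open U \<and> x \<in> U \<and> smooth_on U f) \<Longrightarrow> smooth_on S f"
  unfolding smooth_on_def by (meson Ck_on_local)

lemma smooth_on_subset: "smooth_on S f \<Longrightarrow> T \<subseteq> S \<Longrightarrow> smooth_on T f"
  unfolding smooth_on_def using Ck_on_subset by blast

lemma smooth_on_add: "open S \<Longrightarrow> smooth_on S f \<Longrightarrow> smooth_on S g \<Longrightarrow> smooth_on S (\<lambda>x. f x + g x)"
  by (simp add: smooth_on_def Ck_on_add)

lemma smooth_on_scaleR:
  "open S \<Longrightarrow> smooth_on S f \<Longrightarrow> smooth_on S g \<Longrightarrow> smooth_on S (\<lambda>x. f x *\<^sub>R g x)"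
  by (simp add: smooth_on_def Ck_on_scaleR)

lemma smooth_on_mult:
  fixes f g :: "_ \<Rightarrow> real"
  shows "open S \<Longrightarrow> smooth_on S f \<Longrightarrow> smooth_on S g \<Longrightarrow> smooth_on S (\<lambda>x. f x * g x)"
  using smooth_on_scaleR[of S f g] by simp

lemma smooth_on_linear:
  "bounded_linear h \<Longrightarrow> open S \<Longrightarrow> smooth_on S f \<Longrightarrow> smooth_on S (\<lambda>x. h (f x))"
  by (simp add: smooth_on_def Ck_on_linear)

lemma smooth_on_minus: "open S \<Longrightarrow> smooth_on S f \<Longrightarrow> smooth_on S (\<lambda>x. - f x)"
  using smooth_on_linear[OF bounded_linear_minus[OF bounded_linear_ident]] by blast

lemma smooth_on_diff:
  "open S \<Longrightarrow> smooth_on S f \<Longrightarrow> smooth_on S g \<Longrightarrow> smooth_on S (\<lambda>x. f x - g x)"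
  using smooth_on_add[of S f "\<lambda>x. - g x"] smooth_on_minus[of S g] by simp

lemma smooth_on_inverse:
  fixes f :: "_ \<Rightarrow> real"
  shows "open S \<Longrightarrow> (\<And>x. x \<in> S \<Longrightarrow> f x \<noteq> 0) \<Longrightarrow> smooth_on S f \<Longrightarrow> smooth_on S (\<lambda>x. inverse (f x))"
  by (simp add: smooth_on_def Ck_on_inverse)

lemma smooth_on_sum:
  "open S \<Longrightarrow> (\<And>i. i \<in> I \<Longrightarrow> smooth_on S (f i)) \<Longrightarrow> smooth_on S (\<lambda>x. \<Sum>i\<in>I. f i x)"
  by (simp add: smooth_on_def Ck_on_sum)

lemma smooth_on_prod:
  fixes f :: "_ \<Rightarrow> _ \<Rightarrow> real"
  assumes "open S" "\<And>i. i \<in> I \<Longrightarrow> smooth_on S (f i)"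
  shows "smooth_on S (\<lambda>x. \<Prod>i\<in>I. f i x)"
  using assms(2)
  by (induction I rule: infinite_finite_induct) (auto intro!: smooth_on_mult assms(1))

lemma smooth_on_imp_continuous_on: "smooth_on S f \<Longrightarrow> continuous_on S f"
  unfolding smooth_on_def by (metis Ck_on.simps(1))

lemma smooth_on_frechet_derivative:
  "smooth_on S f \<Longrightarrow> smooth_on S (\<lambda>x. frechet_derivative f (at x) v)"
  unfolding smooth_on_def by (metis Ck_on.simps(2))

lemma smooth_on_has_derivative:
  "smooth_on S f \<Longrightarrow> x \<in> S \<Longrightarrow> (f has_derivative frechet_derivative f (at x)) (at x)"
  unfolding smooth_on_def by (metis Ck_on.simps(2) frechet_derivative_works)

section \<open>Finite-dimensional inner product spaces\<close>

text \<open>Plays the role of \<open>Basis\<close> in the class \<open>euclidean_space\<close>; the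
  empty set is a legitimate instance, so dimension 0 is included.\<close>

locale orthonormal_basis =
  fixes \<B> :: "'e::real_inner set"
  assumes finite_basis: "finite \<B>"
    and inner_basis: "u \<in> \<B> \<Longrightarrow> v \<in> \<B> \<Longrightarrow> inner u v = (if u = v then 1 else 0)"
    and span_basis: "span \<B> = UNIV"

lemma orthonormal_basis_exists:
  assumes "\<exists>B::'e::real_inner set. finite B \<and> span B = UNIV"
  shows "\<exists>B::'e set. orthonormal_basis B"
proof -
  obtain C :: "'e set" where C: "finite C" "span C = UNIV" "pairwise real_inner_class.orthogonal C"
    using assms basis_orthogonal by metis
  \<comment> \<open>An orthogonal spanning set may contain 0, which cannot be normalised and adds
    nothing to the span.\<close>
  define D where "D = (\<lambda>x. x /\<^sub>R norm x) ` (C - {0})"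
  have "C \<subseteq> span D"
  proof
    fix x assume "x \<in> C"
    show "x \<in> span D"
    proof (cases "x = 0")
      case False
      then have "x /\<^sub>R norm x \<in> D" using \<open>x \<in> C\<close> by (auto simp: D_def)
      then have "norm x *\<^sub>R (x /\<^sub>R norm x) \<in> span D" by (intro span_scale span_base)
      with False show ?thesis by simp
    qed (simp add: span_zero)
  qed
  then have "span D = UNIV" using C(2) by (metis span_mono span_span top.extremum_uniqueI)
  moreover have "inner u v = (if u = v then 1 else 0)" if "u \<in> D" "v \<in> D" for u v
  proof -
    note uv = that
    obtain x y where xy: "x \<in> C" "x \<noteq> 0" "y \<in> C" "y \<noteq> 0" "u = x /\<^sub>R norm x" "v = y /\<^sub>R norm y"
      using uv unfolding D_def by (elim imageE DiffE) blast
    have "inner u u = 1"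
      using xy by (simp add: power2_norm_eq_inner[symmetric] power2_eq_square)
    moreover have "inner u v = 0" if "x \<noteq> y"
      using C(3) xy that by (simp add: pairwise_def real_inner_class.orthogonal_def)
    ultimately show ?thesis using xy by (metis zero_neq_one)
  qed
  ultimately show ?thesis using C(1)
    by (intro exI[of _ D] orthonormal_basis.intro) (auto simp: D_def)
qed

context orthonormal_basis
begin

lemma expand: "(\<Sum>b\<in>\<B>. inner x b *\<^sub>R b) = x"
proof -
  have "x \<in> span \<B>" by (simp add: span_basis)
  then obtain c where "x = (\<Sum>b\<in>\<B>. c b *\<^sub>R b)"
    by (auto simp: span_finite[OF finite_basis])
  moreover have "inner (\<Sum>b\<in>\<B>. c b *\<^sub>R b) b' = c b'" if "b' \<in> \<B>" for b'
  proof -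
    have "inner (\<Sum>b\<in>\<B>. c b *\<^sub>R b) b' = (\<Sum>b\<in>\<B>. if b = b' then c b else 0)"
      unfolding inner_sum_left using that by (intro sum.cong) (auto simp: inner_basis)
    then show ?thesis using that finite_basis by simp
  qed
  ultimately show ?thesis by simp
qed

lemma linear_expand:
  assumes "linear f" shows "f x = (\<Sum>b\<in>\<B>. inner x b *\<^sub>R f b)"
proof -
  have "f x = f (\<Sum>b\<in>\<B>. inner x b *\<^sub>R b)" by (simp add: expand)
  also have "\<dots> = (\<Sum>b\<in>\<B>. inner x b *\<^sub>R f b)"
    by (simp add: linear_sum[OF assms] linear_scale[OF assms])
  finally show ?thesis .
qed

lemma linear_imp_bounded_linear:
  fixes f :: "'e \<Rightarrow> 'b::real_normed_vector"
  assumes "linear f" shows "bounded_linear f"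
proof -
  have "bounded_linear (\<lambda>x. \<Sum>b\<in>\<B>. inner x b *\<^sub>R f b)"
    by (intro bounded_linear_sum bounded_linear_scaleR_const bounded_linear_inner_left)
  moreover have "(\<lambda>x. \<Sum>b\<in>\<B>. inner x b *\<^sub>R f b) = f"
    by (rule ext) (rule linear_expand[OF assms, symmetric])
  ultimately show ?thesis by simp
qed

lemma independent_basis: "independent \<B>"
  by (rule pairwise_orthogonal_independent)
    (use inner_basis[of 0 0] in \<open>auto simp: pairwise_def real_inner_class.orthogonal_def inner_basis\<close>)

text \<open>In the chain rule the direction in which f is differentiated moves with x, whereas
  \<open>Ck_on\<close> controls fixed directions only. Expanding it in the basis leaves finitely
  many fixed directions, with coefficients of the right order.\<close>

lemma Ck_on_compose:
  fixes g :: "'a::real_normed_vector \<Rightarrow> 'e" and f :: "'e \<Rightarrow> 'c::real_normed_vector"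
  assumes "open S" "open T" "g ` S \<subseteq> T" "Ck_on k T f" "Ck_on k S g"
  shows "Ck_on k S (\<lambda>x. f (g x))"
  using assms(4,5)
proof (induction k arbitrary: f)
  case 0
  then show ?case using assms(3) by (auto intro: continuous_on_compose2)
next
  case (Suc k)
  note D = Suc.prems[THEN Ck_on_has_derivative] and F = Suc.prems[THEN Ck_on_frechet_derivative]
  let ?Df = "\<lambda>y. frechet_derivative f (at y)" and ?Dg = "\<lambda>x. frechet_derivative g (at x)"
  show ?case
  proof (rule Ck_on_SucI[OF assms(1)])
    fix x assume "x \<in> S"
    then have "g x \<in> T" using assms(3) by auto
    have "((\<lambda>x. f (g x)) has_derivative (\<lambda>v. ?Df (g x) (?Dg x v))) (at x)"
      by (rule has_derivative_compose[OF D(2)[OF \<open>x \<in> S\<close>] D(1)[OF \<open>g x \<in> T\<close>]])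
    moreover have "linear (?Df (g x))"
      using D(1)[OF \<open>g x \<in> T\<close>] by (rule has_derivative_linear)
    ultimately show "((\<lambda>x. f (g x)) has_derivative
        (\<lambda>v. \<Sum>b\<in>\<B>. inner (?Dg x v) b *\<^sub>R ?Df (g x) b)) (at x)"
      by (subst (asm) linear_expand) auto
  next
    fix v
    have "Ck_on k S (\<lambda>x. inner (?Dg x v) b *\<^sub>R ?Df (g x) b)" for b
      by (intro Ck_on_scaleR Ck_on_linear[OF bounded_linear_inner_left] Suc.IH assms(1) F
          Ck_on_Suc_D[OF Suc.prems(2)])
    then show "Ck_on k S (\<lambda>x. \<Sum>b\<in>\<B>. inner (?Dg x v) b *\<^sub>R ?Df (g x) b)"
      by (intro Ck_on_sum assms(1))
  qed
qed

lemma smooth_on_compose: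
  fixes g :: "'a::real_normed_vector \<Rightarrow> 'e" and f :: "'e \<Rightarrow> 'c::real_normed_vector"
  shows "open S \<Longrightarrow> open T \<Longrightarrow> g ` S \<subseteq> T \<Longrightarrow> smooth_on T f \<Longrightarrow> smooth_on S g \<Longrightarrow>
    smooth_on S (\<lambda>x. f (g x))"
  unfolding smooth_on_def using Ck_on_compose by blast

text \<open>A ball around 0 is a closed part of a box of coefficients, and the box is a finite sum
  of segments, each a continuous image of an interval. Compact balls are needed to show that the
  support of a bump function stays closed in the manifold.\<close>

lemma compact_cball_basis: "compact (cball (x::'e) r)"
proof -
  have "compact {\<Sum>b\<in>D. c b *\<^sub>R b | c. \<forall>b\<in>D. \<bar>c b\<bar> \<le> r}" if "finite D" for D :: "'e set"
    using that
  proof (induction D rule: finite_induct)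
    case (insert a D)
    let ?K = "{\<Sum>b\<in>D. c b *\<^sub>R b | c. \<forall>b\<in>D. \<bar>c b\<bar> \<le> r}"
    have "{\<Sum>b\<in>insert a D. c b *\<^sub>R b | c. \<forall>b\<in>insert a D. \<bar>c b\<bar> \<le> r} =
      {y + z | y z. y \<in> (\<lambda>t. t *\<^sub>R a) ` {-r..r} \<and> z \<in> ?K}" (is "?L = ?R")
    proof
      show "?L \<subseteq> ?R" using insert.hyps by (fastforce simp: abs_le_iff)
      show "?R \<subseteq> ?L"
      proof
        fix w assume "w \<in> ?R"
        then obtain t c where tc: "w = t *\<^sub>R a + (\<Sum>b\<in>D. c b *\<^sub>R b)" "\<bar>t\<bar> \<le> r" "\<forall>b\<in>D. \<bar>c b\<bar> \<le> r"
          by (auto simp: abs_le_iff)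
        have "(\<Sum>b\<in>D. c b *\<^sub>R b) = (\<Sum>b\<in>D. (c(a := t)) b *\<^sub>R b)"
          using insert.hyps by (intro sum.cong) auto
        then have "w = (\<Sum>b\<in>insert a D. (c(a := t)) b *\<^sub>R b)"
          using tc insert.hyps by simp
        moreover have "\<forall>b\<in>insert a D. \<bar>(c(a := t)) b\<bar> \<le> r" using tc by simp
        ultimately show "w \<in> ?L" by blast
      qed
    qed
    moreover have "compact ((\<lambda>t. t *\<^sub>R a) ` {-r..r})"
      by (intro compact_continuous_image continuous_intros compact_Icc)
    ultimately show ?case using insert.IH by (simp only: compact_sums)
  qed simp
  from this[OF finite_basis] have K: "compact {\<Sum>b\<in>\<B>. c b *\<^sub>R b | c. \<forall>b\<in>\<B>. \<bar>c b\<bar> \<le> r}" .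
  have "cball 0 r \<subseteq> {\<Sum>b\<in>\<B>. c b *\<^sub>R b | c. \<forall>b\<in>\<B>. \<bar>c b\<bar> \<le> r}"
  proof
    fix y :: 'e assume "y \<in> cball 0 r"
    moreover have "\<bar>inner y b\<bar> \<le> norm y" if "b \<in> \<B>" for b
    proof -
      have "norm b = 1" using inner_basis[OF that that] by (simp add: norm_eq_1)
      then show ?thesis using Cauchy_Schwarz_ineq2[of y b] by simp
    qed
    ultimately show "y \<in> {\<Sum>b\<in>\<B>. c b *\<^sub>R b | c. \<forall>b\<in>\<B>. \<bar>c b\<bar> \<le> r}"
      by (intro CollectI exI[of _ "\<lambda>b. inner y b"] conjI ballI expand[symmetric])
        (auto intro: order_trans)
  qed
  then have "compact (cball (0::'e) r)"
    using compact_Int_closed[OF K closed_cball[of 0 r]] by (simp only: Int_absorb1)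
  then have "compact ((+) x ` cball 0 r)" by (intro compact_continuous_image continuous_intros)
  then show ?thesis by simp
qed

end

lemma orthonormal_basis_real: "orthonormal_basis {1::real}"
proof
  show "span {1::real} = UNIV" by (auto simp: span_singleton image_iff)
qed auto

section \<open>Bump functions\<close>


text \<open>The standard flat function is exp(-1/t), continued by 0. Its derivatives leave that form
  but stay in the family with a polynomial factor in 1/t, so the induction on the order of
  smoothness runs over all q.\<close>

definition bump_poly :: "real poly \<Rightarrow> real \<Rightarrow> real" where
  "bump_poly q t = (if t > 0 then poly q (1 / t) * exp (- (1 / t)) else 0)"

lemma poly_times_exp_minus_tendsto_0: "((\<lambda>s. poly q s * exp (- s)) \<longlongrightarrow> (0::real)) at_top"
proof -
  have "((\<lambda>s. \<Sum>i\<le>degree q. coeff q i * (s ^ i / exp s)) \<longlongrightarrow> (\<Sum>i\<le>degree q. coeff q i * 0)) at_top"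
    by (intro tendsto_sum tendsto_mult tendsto_const tendsto_power_div_exp_0)
  moreover have "poly q s * exp (- s) = (\<Sum>i\<le>degree q. coeff q i * (s ^ i / exp s))" for s :: real
    by (simp add: poly_altdef sum_distrib_right exp_minus divide_inverse mult.assoc)
  ultimately show ?thesis by simp
qed

text \<open>With s = 1/t one has ds/dt = -s^2, and q(s) exp(-s) has s-derivative (q' - q)(s)
  exp(-s); this gives the polynomial s^2 (q - q').\<close>

lemma bump_poly_has_derivative:
  "(bump_poly q has_real_derivative bump_poly ([:0, 0, 1:] * (q - pderiv q)) t) (at t)"
proof -
  consider "t > 0" | "t < 0" | "t = 0" by linarith
  then show ?thesis
  proof cases
    case 1
    let ?d = "poly (pderiv q) (1 / t) * (- (1 / t\<^sup>2)) * exp (- (1 / t))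
      + poly q (1 / t) * (exp (- (1 / t)) * (1 / t\<^sup>2))"
    have "((\<lambda>t. 1 / t) has_real_derivative (- (1 / t\<^sup>2))) (at t)"
      using 1 by (auto intro!: derivative_eq_intros simp: power2_eq_square)
    note D = this
    have "((\<lambda>t. poly q (1 / t)) has_real_derivative poly (pderiv q) (1 / t) * (- (1 / t\<^sup>2))) (at t)"
      using DERIV_chain2[OF poly_DERIV D] .
    moreover have "((\<lambda>t. exp (- (1 / t))) has_real_derivative exp (- (1 / t)) * (1 / t\<^sup>2)) (at t)"
      using DERIV_chain2[OF DERIV_exp DERIV_minus[OF D]] by simp
    ultimately have "((\<lambda>t. poly q (1 / t) * exp (- (1 / t))) has_real_derivative ?d) (at t)"
      by (auto intro: DERIV_mult[THEN DERIV_cong])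
    then have "(bump_poly q has_real_derivative ?d) (at t)"
      by (rule DERIV_cong_ev[THEN iffD1, rotated -1])
        (use 1 eventually_nhds_in_open[of "{0<..}" t] in \<open>auto simp: bump_poly_def elim!: eventually_mono\<close>)
    moreover have "?d = bump_poly ([:0, 0, 1:] * (q - pderiv q)) t"
      using 1 by (simp add: bump_poly_def power2_eq_square algebra_simps)
    ultimately show ?thesis by simp
  next
    case 2
    have "((\<lambda>t. 0) has_real_derivative 0) (at t)" by simp
    then have "(bump_poly q has_real_derivative 0) (at t)"
      by (rule DERIV_cong_ev[THEN iffD1, rotated -1])
        (use 2 eventually_nhds_in_open[of "{..<0}" t] in \<open>auto simp: bump_poly_def elim!: eventually_mono\<close>)
    then show ?thesis using 2 by (simp add: bump_poly_def)
  next
    case 3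
    \<comment> \<open>At 0 the difference quotient vanishes on the left, and on the right it is s
      q(s) exp(-s) with s = 1/h tending to infinity.\<close>
    have "((\<lambda>h. bump_poly q h / h) \<longlongrightarrow> 0) (at_left 0)"
    proof (rule tendsto_eventually)
      show "\<forall>\<^sub>F h in at_left 0. bump_poly q h / h = 0"
        unfolding eventually_at_filter by (auto simp: bump_poly_def)
    qed
    moreover have "((\<lambda>h. bump_poly q h / h) \<longlongrightarrow> 0) (at_right 0)"
      unfolding filterlim_at_right_to_top
    proof (rule Lim_transform_eventually[OF poly_times_exp_minus_tendsto_0[of "[:0, 1:] * q"]])
      show "\<forall>\<^sub>F s in at_top. poly ([:0, 1:] * q) s * exp (- s) = bump_poly q (inverse s) / inverse s"
        using eventually_gt_at_top[of 0]
        by eventually_elim (auto simp: bump_poly_def field_simps)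
    qed
    ultimately have "((\<lambda>h. bump_poly q h / h) \<longlongrightarrow> 0) (at 0)" by (rule filterlim_split_at)
    then show ?thesis using 3 by (simp add: has_field_derivative_def DERIV_def[unfolded has_field_derivative_def] bump_poly_def)
  qed
qed

lemma Ck_on_bump_poly: "Ck_on k UNIV (bump_poly q)"
proof (induction k arbitrary: q)
  case 0
  have "isCont (bump_poly q) t" for t
    using DERIV_isCont bump_poly_has_derivative by blast
  then show ?case by (simp add: continuous_at_imp_continuous_on)
next
  case (Suc k)
  let ?q = "[:0, 0, 1:] * (q - pderiv q)"
  have D: "(bump_poly q has_derivative (\<lambda>v. bump_poly ?q t * v)) (at t)" for t
    using bump_poly_has_derivative[of q t] by (simp add: has_field_derivative_def)
  have "frechet_derivative (bump_poly q) (at t) v = bump_poly ?q t * v" for t v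
    using frechet_derivative_at[OF D, of t] by metis
  moreover have "Ck_on k UNIV (\<lambda>t. bump_poly ?q t * v)" for v
    by (intro Ck_on_linear[OF bounded_linear_mult_left] Suc.IH open_UNIV)
  moreover have "bump_poly q differentiable (at t)" for t
    using D by (auto simp: differentiable_def)
  ultimately show ?case by simp
qed

lemma (in orthonormal_basis) bump_function:
  fixes x :: 'e
  assumes "R > 0"
  shows "\<exists>h::'e \<Rightarrow> real. smooth_on UNIV h \<and> h x \<noteq> 0 \<and> (\<forall>y. h y \<noteq> 0 \<longrightarrow> dist x y < R)"
proof -
  \<comment> \<open>The reals are the middle space of the composition in \<open>?h\<close>, and
    \<open>smooth_on_compose\<close> asks for a basis there.\<close>
  interpret R: orthonormal_basis "{1::real}" by (rule orthonormal_basis_real)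
  \<comment> \<open>R^2 - |y - x|^2 is smooth in y and positive exactly on the open ball.\<close>
  let ?h = "\<lambda>y. bump_poly 1 (R\<^sup>2 - inner (y - x) (y - x))"
  have sq: "(\<Sum>b\<in>\<B>. inner y b * inner y b) = inner y y" for y :: 'e
    using arg_cong[OF expand[of y], of "inner y"] by (simp add: inner_sum_right)
  have "smooth_on UNIV (\<lambda>y. inner (y - x) b)" for b
    by (rule smooth_on_linear[OF bounded_linear_inner_left])
      (auto intro: smooth_on_diff smooth_on_id)
  then have "smooth_on UNIV (\<lambda>y. \<Sum>b\<in>\<B>. inner (y - x) b * inner (y - x) b)"
    by (intro smooth_on_sum smooth_on_mult open_UNIV)
  then have "smooth_on UNIV (\<lambda>y. R\<^sup>2 - inner (y - x) (y - x))"
    unfolding sq by (intro smooth_on_diff smooth_on_const open_UNIV)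
  then have "smooth_on UNIV ?h"
    by (rule R.smooth_on_compose[OF open_UNIV open_UNIV subset_UNIV, rotated])
      (simp add: smooth_on_def Ck_on_bump_poly)
  moreover have "?h x \<noteq> 0" using assms by (simp add: bump_poly_def)
  moreover have "dist x y < R" if "?h y \<noteq> 0" for y
  proof -
    have "inner (y - x) (y - x) < R\<^sup>2" using that by (auto simp: bump_poly_def split: if_splits)
    then have "(norm (y - x))\<^sup>2 < R\<^sup>2" by (simp add: power2_norm_eq_inner)
    then show ?thesis using assms
      by (metis dist_commute dist_norm less_eq_real_def power2_less_imp_less)
  qed
  ultimately show ?thesis by blast
qed

section \<open>Families of vectors and Gram matrices\<close>

text \<open>Coefficients indexed by numbers compare directly with the kernel of a Gram matrix;
  \<open>linindep_iff\<close> links this to the shape of frames in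
  \<open>subbundle_of_rank\<close>.\<close>

definition linindep :: "nat \<Rightarrow> (nat \<Rightarrow> 'v::real_vector) \<Rightarrow> bool" where
  "linindep k v \<longleftrightarrow> (\<forall>c. (\<Sum>i<k. c i *\<^sub>R v i) = 0 \<longrightarrow> (\<forall>i<k. c i = 0))"

lemma linindep_iff: "linindep k v \<longleftrightarrow> inj_on v {..<k} \<and> independent (v ` {..<k})"
proof
  assume ind: "linindep k v"
  have inj: "inj_on v {..<k}"
  proof (rule inj_onI, rule ccontr)
    fix i j assume ij: "i \<in> {..<k}" "j \<in> {..<k}" "v i = v j" "i \<noteq> j"
    \<comment> \<open>If v i = v j, the difference of the unit coefficient vectors at i and j is a
      nontrivial relation.\<close>
    define c :: "nat \<Rightarrow> real" where "c l = (if l = i then 1 else 0) - (if l = j then 1 else 0)" for l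
    have "(\<Sum>l<k. c l *\<^sub>R v l) =
        (\<Sum>l<k. (if l = i then v l else 0)) - (\<Sum>l<k. (if l = j then v l else 0))"
      unfolding c_def sum_subtractf[symmetric] by (intro sum.cong) auto
    also have "\<dots> = 0" using ij by simp
    finally have "c i = 0" using ind ij by (auto simp: linindep_def)
    then show False using ij by (simp add: c_def)
  qed
  moreover have "independent (v ` {..<k})"
    unfolding independent_explicit_finite_subsets
  proof (intro allI impI ballI)
    fix S u x assume S: "S \<subseteq> v ` {..<k}" "finite S" "(\<Sum>x\<in>S. u x *\<^sub>R x) = 0" "x \<in> S"
    have "(\<Sum>i<k. (if v i \<in> S then u (v i) else 0) *\<^sub>R v i) =
        (\<Sum>x\<in>v ` {..<k}. (if x \<in> S then u x else 0) *\<^sub>R x)"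
      using inj by (simp add: sum.reindex)
    also have "\<dots> = (\<Sum>x\<in>S. u x *\<^sub>R x)"
      using S by (intro sum.mono_neutral_cong_right) auto
    finally have "\<forall>i<k. (if v i \<in> S then u (v i) else 0) = 0"
      using S(3) ind[unfolded linindep_def, THEN spec, of "\<lambda>i. if v i \<in> S then u (v i) else 0"] by simp
    moreover obtain i where "i < k" "x = v i" using S by blast
    ultimately show "u x = 0" using S(4) by auto
  qed
  ultimately show "inj_on v {..<k} \<and> independent (v ` {..<k})" by blast
next
  assume *: "inj_on v {..<k} \<and> independent (v ` {..<k})"
  show "linindep k v" unfolding linindep_def
  proof (intro allI impI)
    fix c i assume c: "(\<Sum>i<k. c i *\<^sub>R v i) = 0" and i: "i < k"
    define u where "u x = c (the_inv_into {..<k} v x)" for x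
    have u: "u (v j) = c j" if "j < k" for j
      using * that by (simp add: u_def the_inv_into_f_f)
    have "(\<Sum>x\<in>v ` {..<k}. u x *\<^sub>R x) = (\<Sum>i<k. c i *\<^sub>R v i)"
      using * u by (simp add: sum.reindex)
    then have "(\<Sum>x\<in>v ` {..<k}. u x *\<^sub>R x) = 0" using c by simp
    from conjunct2[OF *, unfolded independent_explicit_finite_subsets, rule_format, OF subset_refl _ this]
    have "u (v i) = 0" using i by blast
    then show "c i = 0" using u[OF i] by simp
  qed
qed

lemma span_image_lessThan:
  fixes k :: nat
  shows "span (v ` {..<k}) = {\<Sum>i<k. c i *\<^sub>R v i | c. True}"
proof
  show "{\<Sum>i<k. c i *\<^sub>R v i | c. True} \<subseteq> span (v ` {..<k})"
    by (auto intro!: span_sum intro: span_scale span_base)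
  have "subspace {\<Sum>i<k. c i *\<^sub>R v i | c. True}"
  proof (rule subspaceI)
    show "0 \<in> {\<Sum>i<k. c i *\<^sub>R v i | c. True}" by (auto intro!: exI[of _ "\<lambda>_. 0"])
  next
    fix x y assume "x \<in> {\<Sum>i<k. c i *\<^sub>R v i | c. True}" "y \<in> {\<Sum>i<k. c i *\<^sub>R v i | c. True}"
    then obtain c d where "x = (\<Sum>i<k. c i *\<^sub>R v i)" "y = (\<Sum>i<k. d i *\<^sub>R v i)" by auto
    then have "x + y = (\<Sum>i<k. (c i + d i) *\<^sub>R v i)" by (simp add: scaleR_left_distrib sum.distrib)
    then show "x + y \<in> {\<Sum>i<k. c i *\<^sub>R v i | c. True}" by auto
  next
    fix r x assume "x \<in> {\<Sum>i<k. c i *\<^sub>R v i | c. True}"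
    then obtain c where "x = (\<Sum>i<k. c i *\<^sub>R v i)" by auto
    then have "r *\<^sub>R x = (\<Sum>i<k. (r * c i) *\<^sub>R v i)" by (simp add: scaleR_sum_right)
    then show "r *\<^sub>R x \<in> {\<Sum>i<k. c i *\<^sub>R v i | c. True}" by auto
  qed
  moreover have "v ` {..<k} \<subseteq> {\<Sum>i<k. c i *\<^sub>R v i | c. True}"
  proof clarify
    fix i assume "i < k"
    have "(\<Sum>l<k. (if l = i then 1 else 0) *\<^sub>R v l) = (\<Sum>l<k. if l = i then v l else 0)"
      by (intro sum.cong) auto
    also have "\<dots> = v i" using \<open>i < k\<close> by simp
    finally show "\<exists>c. v i = (\<Sum>i<k. c i *\<^sub>R v i) \<and> True" by metis
  qed
  ultimately show "span (v ` {..<k}) \<subseteq> {\<Sum>i<k. c i *\<^sub>R v i | c. True}"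
    by (rule span_minimal[rotated])
qed

definition mdet :: "nat \<Rightarrow> (nat \<Rightarrow> nat \<Rightarrow> real) \<Rightarrow> real" where
  "mdet k G = Determinant.det (Matrix.mat k k (\<lambda>(i, j). G i j))"

text \<open>Written as adjugate over determinant, so that every entry is visibly a polynomial in the
  entries of G divided by the determinant, hence smooth when G is.\<close>

definition minv :: "nat \<Rightarrow> (nat \<Rightarrow> nat \<Rightarrow> real) \<Rightarrow> nat \<Rightarrow> nat \<Rightarrow> real" where
  "minv k G i j = adj_mat (Matrix.mat k k (\<lambda>(i, j). G i j)) $$ (i, j) / mdet k G"

lemma mdet_nonzero_iff:
  "mdet k G \<noteq> 0 \<longleftrightarrow> (\<forall>c. (\<forall>i<k. (\<Sum>j<k. G i j * c j) = 0) \<longrightarrow> (\<forall>j<k. c j = 0))"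
proof -
  let ?A = "Matrix.mat k k (\<lambda>(i, j). G i j)"
  have A: "?A \<in> carrier_mat k k" by simp
  have mult: "?A *\<^sub>v v = 0\<^sub>v k \<longleftrightarrow> (\<forall>i<k. (\<Sum>j<k. G i j * vec_index v j) = 0)"
    if "v \<in> carrier_vec k" for v
    using that by (auto simp: Matrix.vec_eq_iff scalar_prod_def atLeast0LessThan)
  have "mdet k G = 0 \<longleftrightarrow> (\<exists>v. v \<in> carrier_vec k \<and> v \<noteq> 0\<^sub>v k \<and> ?A *\<^sub>v v = 0\<^sub>v k)"
    unfolding mdet_def by (rule det_0_iff_vec_prod_zero_field[OF A])
  also have "\<dots> \<longleftrightarrow> (\<exists>c. (\<forall>i<k. (\<Sum>j<k. G i j * c j) = 0) \<and> \<not> (\<forall>j<k. c j = 0))"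
  proof
    assume "\<exists>v. v \<in> carrier_vec k \<and> v \<noteq> 0\<^sub>v k \<and> ?A *\<^sub>v v = 0\<^sub>v k"
    then obtain v where v: "v \<in> carrier_vec k" "v \<noteq> 0\<^sub>v k" "?A *\<^sub>v v = 0\<^sub>v k" by blast
    moreover have "\<not> (\<forall>j<k. vec_index v j = 0)" using v by (auto simp: Matrix.vec_eq_iff)
    ultimately show "\<exists>c. (\<forall>i<k. (\<Sum>j<k. G i j * c j) = 0) \<and> \<not> (\<forall>j<k. c j = 0)"
      using mult by blast
  next
    assume "\<exists>c. (\<forall>i<k. (\<Sum>j<k. G i j * c j) = 0) \<and> \<not> (\<forall>j<k. c j = 0)"
    then obtain c where "\<forall>i<k. (\<Sum>j<k. G i j * c j) = 0" "\<not> (\<forall>j<k. c j = 0)" by blast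
    then show "\<exists>v. v \<in> carrier_vec k \<and> v \<noteq> 0\<^sub>v k \<and> ?A *\<^sub>v v = 0\<^sub>v k"
      by (intro exI[of _ "Matrix.vec k c"]) (auto simp: scalar_prod_def atLeast0LessThan Matrix.vec_eq_iff)
  qed
  finally show ?thesis by blast
qed

lemma minv_right:
  assumes "mdet k G \<noteq> 0" "i < k" "l < k"
  shows "(\<Sum>j<k. G i j * minv k G j l) = (if i = l then 1 else 0)"
proof -
  let ?A = "Matrix.mat k k (\<lambda>(i, j). G i j)"
  have A: "?A \<in> carrier_mat k k" by simp
  have "(?A * adj_mat ?A) $$ (i, l) = (mdet k G \<cdot>\<^sub>m 1\<^sub>m k) $$ (i, l)"
    using adj_mat(2)[OF A] by (simp add: mdet_def)
  moreover have "(?A * adj_mat ?A) $$ (i, l) = (\<Sum>j<k. G i j * adj_mat ?A $$ (j, l))"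
    using assms adj_mat(1)[OF A] by (simp add: scalar_prod_def atLeast0LessThan)
  ultimately have "(\<Sum>j<k. G i j * adj_mat ?A $$ (j, l)) = (if i = l then mdet k G else 0)"
    using assms by simp
  then show ?thesis using assms(1)
    by (simp add: minv_def sum_divide_distrib[symmetric])
qed

lemma smooth_on_mdet:
  assumes "open S" "\<And>i j. i < k \<Longrightarrow> j < k \<Longrightarrow> smooth_on S (\<lambda>y. G y i j)"
  shows "smooth_on S (\<lambda>y. mdet k (G y))"
proof -
  have "mdet k (G y) = (\<Sum>p\<in>{p. p permutes {0..<k}}. signof p * (\<Prod>i = 0..<k. G y i (p i)))" for y
    unfolding mdet_def Determinant.det_def
    by (auto intro!: sum.cong prod.cong dest: permutes_in_image)
  moreover have "smooth_on S (\<lambda>y. \<Sum>p\<in>{p. p permutes {0..<k}}. signof p * (\<Prod>i = 0..<k. G y i (p i)))"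
    by (intro smooth_on_sum smooth_on_mult smooth_on_const smooth_on_prod assms) auto
  ultimately show ?thesis by simp
qed

lemma smooth_on_minv:
  assumes "open S" "\<And>i j. i < k \<Longrightarrow> j < k \<Longrightarrow> smooth_on S (\<lambda>y. G y i j)"
    and "\<And>y. y \<in> S \<Longrightarrow> mdet k (G y) \<noteq> 0" "i < k" "j < k"
  shows "smooth_on S (\<lambda>y. minv k (G y) i j)"
proof -
  \<comment> \<open>\<open>?s l\<close> enumerates the indices other than l. The adjugate is the
    transposed cofactor matrix, so the entry (i, j) deletes row j and column i.\<close>
  let ?s = "\<lambda>l a. if a < l then a else Suc a"
  have "minv k (G y) i j =
      ((- 1) ^ (j + i) * mdet (k - 1) (\<lambda>a b. G y (?s j a) (?s i b))) * inverse (mdet k (G y))" for y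
  proof -
    have "mat_delete (Matrix.mat k k (\<lambda>(i, j). G y i j)) j i =
        Matrix.mat (k - 1) (k - 1) (\<lambda>(a, b). G y (?s j a) (?s i b))"
      using assms(4,5) unfolding mat_delete_def by (auto intro!: eq_matI)
    then show ?thesis using assms(4,5)
      by (simp add: minv_def adj_mat_def cofactor_def mdet_def divide_inverse)
  qed
  moreover have "smooth_on S (\<lambda>y. ((- 1) ^ (j + i) *
      mdet (k - 1) (\<lambda>a b. G y (?s j a) (?s i b))) * inverse (mdet k (G y)))"
    by (intro smooth_on_mult smooth_on_const smooth_on_inverse smooth_on_mdet assms) (use assms in auto)
  ultimately show ?thesis by simp
qed

text \<open>A kernel vector c of the Gram matrix makes x = \<Sum> c_j v_j orthogonal to every v_i,
  hence to itself, so x = 0. This turns independence into an open condition.\<close>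

lemma linindep_iff_gram:
  fixes v :: "nat \<Rightarrow> 'v::real_inner"
  shows "linindep k v \<longleftrightarrow> mdet k (\<lambda>i j. inner (v i) (v j)) \<noteq> 0"
proof -
  have "(\<Sum>j<k. c j *\<^sub>R v j) = 0 \<longleftrightarrow> (\<forall>i<k. (\<Sum>j<k. inner (v i) (v j) * c j) = 0)" for c
  proof -
    let ?x = "\<Sum>j<k. c j *\<^sub>R v j"
    have "(\<Sum>j<k. inner (v i) (v j) * c j) = inner (v i) ?x" for i
      by (simp add: inner_sum_right mult.commute)
    moreover have "inner ?x ?x = (\<Sum>i<k. c i * inner (v i) ?x)"
      by (simp only: inner_sum_left inner_scaleR_left)
    ultimately show ?thesis
      by (metis (no_types, lifting) inner_eq_zero_iff inner_zero_right lessThan_iff mult_zero_right sum.neutral)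
  qed
  then show ?thesis by (simp add: mdet_nonzero_iff linindep_def)
qed

lemma linindep_linear_image:
  assumes "linear f" "inj f" "linindep k v"
  shows "linindep k (\<lambda>i. f (v i))"
proof -
  have "(\<Sum>i<k. c i *\<^sub>R f (v i)) = f (\<Sum>i<k. c i *\<^sub>R v i)" for c
    by (simp add: linear_sum[OF assms(1)] linear_scale[OF assms(1)])
  moreover have "f x = 0 \<longleftrightarrow> x = 0" for x
    using assms(1,2) by (metis injD linear_0)
  ultimately show ?thesis using assms(3) by (simp add: linindep_def)
qed

section \<open>The adjoint action of a 2-form\<close>

lemma wedge_add_left: "wedge (\<lambda>vs. \<zeta> vs + \<eta> vs) \<omega> vs = wedge \<zeta> \<omega> vs + wedge \<eta> \<omega> vs"
proof (induction vs arbitrary: \<zeta> \<eta> \<omega>)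
  case (Cons X vs)
  have "parity (\<lambda>vs. \<zeta> vs + \<eta> vs) = (\<lambda>vs. parity \<zeta> vs + parity \<eta> vs)"
    "interior_product X (\<lambda>vs. \<zeta> vs + \<eta> vs) = (\<lambda>vs. interior_product X \<zeta> vs + interior_product X \<eta> vs)"
    by (simp_all add: parity_def interior_product_def fun_eq_iff algebra_simps)
  with Cons show ?case by simp
qed (simp add: algebra_simps)

lemma interior_product_wedge_one_form:
  "interior_product X (wedge (one_form \<alpha>) \<omega>) =
    (\<lambda>vs. blinfun_apply \<alpha> X * \<omega> vs + (- 1) * wedge (one_form \<alpha>) (interior_product X \<omega>) vs)"
  by (rule ext) (simp add: interior_product_def[of X "wedge (one_form \<alpha>) \<omega>"] wedge_one_form_Cons
      del: wedge.simps)

context orthonormal_basis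
begin

text \<open>For a 2-form B this is \<iota>_X B as a covector; \<open>bounded_linear_slot\<close>
  makes the use of \<open>Blinfun\<close> meaningful.\<close>

definition slot :: "'e form \<Rightarrow> 'e \<Rightarrow> 'e covector" where
  "slot B X = Blinfun (\<lambda>v. B [X, v])"

lemma bounded_linear_slot:
  fixes B :: "'e form"
  assumes "B \<in> forms" shows "bounded_linear (\<lambda>v. B [X, v])"
proof -
  have "linear (\<lambda>v. B ([X] @ v # []))" using assms unfolding forms_def by blast
  then show ?thesis by (intro linear_imp_bounded_linear) simp
qed

lemma blinfun_apply_slot: "B \<in> forms \<Longrightarrow> blinfun_apply (slot B X) v = B [X, v]"
  by (simp add: slot_def bounded_linear_Blinfun_apply bounded_linear_slot)

lemma slot_uminus: "B \<in> forms \<Longrightarrow> slot (\<lambda>vs. - B vs) X = - slot B X"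
  using bounded_linear_slot[of B X]
  by (intro blinfun_eqI)
    (simp add: slot_def bounded_linear_Blinfun_apply bounded_linear_minus uminus_blinfun.rep_eq)

end

section \<open>The exponential of a 2-form and conjugation by it\<close>

locale two_form = orthonormal_basis \<B> for \<B> :: "'e::real_inner set" +
  fixes B :: "'e form"
  assumes two_form: "B \<in> forms_of_degree 2"
begin

lemma form: "B \<in> forms" and zero: "length vs \<noteq> 2 \<Longrightarrow> B vs = 0"
  using two_form by (auto simp: forms_of_degree_def)

lemma parity_two_form: "parity B = B"
proof
  show "parity B vs = B vs" for vs
    by (cases "length vs = 2") (simp_all add: parity_def zero)
qed

lemma interior_product_two_form: "interior_product X B = one_form (slot B X)"
proof
  fix vs show "interior_product X B vs = one_form (slot B X) vs"
  proof (cases "length vs = 1")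
    case True
    then obtain v where "vs = [v]" by (auto simp: length_Suc_conv)
    then show ?thesis by (simp add: interior_product_def one_form_def blinfun_apply_slot form)
  next
    case False
    then show ?thesis
      by (auto simp: interior_product_def one_form_def zero split: list.split)
  qed
qed

lemma interior_product_wedge_two_form:
  "interior_product X (wedge B \<omega>) =
    (\<lambda>vs. wedge (one_form (slot B X)) \<omega> vs + wedge B (interior_product X \<omega>) vs)"
  by (rule ext) (simp add: interior_product_def[of X "wedge B \<omega>"] interior_product_two_form parity_two_form)

text \<open>Contract both sides with the first argument. The terms produced by B contain the
  one-forms \<iota>_X B and \<alpha> in opposite orders, and these anticommute; the rest is the
  induction hypothesis.\<close>

lemma wedge_two_form_one_form:
  "wedge B (wedge (one_form \<alpha>) \<omega>) vs = wedge (one_form \<alpha>) (wedge B \<omega>) vs"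
proof (induction vs arbitrary: \<omega>)
  case Nil
  then show ?case by (simp add: one_form_def zero)
next
  case (Cons X vs)
  have "wedge B (wedge (one_form \<alpha>) \<omega>) (X # vs) =
      interior_product X (wedge B (wedge (one_form \<alpha>) \<omega>)) vs"
    by (simp add: interior_product_def del: wedge.simps)
  also have "\<dots> = wedge (one_form (slot B X)) (wedge (one_form \<alpha>) \<omega>) vs
      + (blinfun_apply \<alpha> X * wedge B \<omega> vs - wedge B (wedge (one_form \<alpha>) (interior_product X \<omega>)) vs)"
    unfolding interior_product_wedge_two_form interior_product_wedge_one_form
      wedge_add_right wedge_scale_right by simp
  also have "\<dots> = blinfun_apply \<alpha> X * wedge B \<omega> vs
      - (wedge (one_form \<alpha>) (wedge (one_form (slot B X)) \<omega>) vs
         + wedge (one_form \<alpha>) (wedge B (interior_product X \<omega>)) vs)"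
    using wedge_one_form_anticommute[of "slot B X" \<alpha> \<omega> vs] Cons[of "interior_product X \<omega>"] by simp
  also have "\<dots> = wedge (one_form \<alpha>) (wedge B \<omega>) (X # vs)"
    unfolding wedge_one_form_Cons interior_product_wedge_two_form wedge_add_right by simp
  finally show ?case .
qed

lemma wedge_pow_one_form:
  "(wedge B ^^ k) (wedge (one_form \<alpha>) \<omega>) = wedge (one_form \<alpha>) ((wedge B ^^ k) \<omega>)"
proof (induction k)
  case (Suc k)
  have "wedge B (wedge (one_form \<alpha>) ((wedge B ^^ k) \<omega>)) = wedge (one_form \<alpha>) (wedge B ((wedge B ^^ k) \<omega>))"
    by (rule ext) (rule wedge_two_form_one_form)
  with Suc show ?case by simp
qed simp

text \<open>Leibniz rule for an even form: the k terms coincide because \<iota>_X B commutes with B.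
  For k = 0 the factor \<open>real k\<close> removes the term with the truncated exponent.\<close>

lemma interior_product_wedge_pow:
  "interior_product X ((wedge B ^^ k) \<omega>) vs =
    (wedge B ^^ k) (interior_product X \<omega>) vs +
    real k * (wedge B ^^ (k - 1)) (wedge (one_form (slot B X)) \<omega>) vs"
proof (induction k arbitrary: vs)
  case (Suc k)
  let ?\<beta> = "one_form (slot B X)"
  have IH: "interior_product X ((wedge B ^^ k) \<omega>) = (\<lambda>vs. (wedge B ^^ k) (interior_product X \<omega>) vs +
    real k * (wedge B ^^ (k - 1)) (wedge ?\<beta> \<omega>) vs)"
    by (rule ext) (rule Suc.IH)
  have "real k * wedge B ((wedge B ^^ (k - 1)) (wedge ?\<beta> \<omega>)) vs =
      real k * wedge ?\<beta> ((wedge B ^^ k) \<omega>) vs"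
    by (cases k) (simp_all add: wedge_pow_one_form[symmetric] wedge_two_form_one_form[symmetric])
  then show ?case
    by (simp add: interior_product_wedge_two_form IH wedge_add_right wedge_scale_right
        wedge_pow_one_form algebra_simps)
qed simp

text \<open>Makes the exponential series finite on each list. A contraction removes one argument and
  at most one factor B, so the bound by the length passes to the tail.\<close>

lemma wedge_pow_eq_0: "length vs < k \<Longrightarrow> (wedge B ^^ k) \<omega> vs = 0"
proof (induction vs arbitrary: k \<omega>)
  case Nil
  then show ?case by (cases k) (simp_all add: zero)
next
  case (Cons X vs)
  have "(wedge B ^^ k) \<omega> (X # vs) = interior_product X ((wedge B ^^ k) \<omega>) vs"
    by (simp add: interior_product_def)
  then show ?case using Cons
    by (simp add: interior_product_wedge_pow)
qed

text \<open>N is left free because contraction shifts the range of summation by one.\<close>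

lemma exp_op_eq_sum:
  assumes "length vs < N"
  shows "exp_op B \<omega> vs = (\<Sum>k<N. (wedge B ^^ k) \<omega> vs / fact k)"
  unfolding exp_op_def using assms by (intro suminf_finite) (auto simp: wedge_pow_eq_0)

lemma exp_op_Nil: "exp_op B \<omega> [] = \<omega> []"
  by (simp add: exp_op_eq_sum[of _ 1])

lemma exp_op_one_form: "exp_op B (wedge (one_form \<alpha>) \<omega>) vs = wedge (one_form \<alpha>) (exp_op B \<omega>) vs"
proof -
  \<comment> \<open>The series is finite only list by list. The wedge product with a one-form at
    \<open>vs\<close> looks only at lists no longer than \<open>vs\<close>, so one truncation serves
    them all.\<close>
  have shrink: "wedge (one_form \<alpha>) \<omega> vs = wedge (one_form \<alpha>) \<eta> vs"
    if "\<And>us. length us \<le> length vs \<Longrightarrow> \<omega> us = \<eta> us" for \<omega> \<eta> :: "'e form"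
    using that
  proof (induction vs arbitrary: \<omega> \<eta>)
    case (Cons X vs)
    have "wedge (one_form \<alpha>) (interior_product X \<omega>) vs = wedge (one_form \<alpha>) (interior_product X \<eta>) vs"
      by (rule Cons.IH) (auto simp: interior_product_def intro: Cons.prems)
    then show ?case unfolding wedge_one_form_Cons using Cons.prems by simp
  qed simp
  have sum: "wedge (one_form \<alpha>) (\<lambda>us. \<Sum>k<n. f k us / c k) vs = (\<Sum>k<n. wedge (one_form \<alpha>) (f k) vs / c k)"
    for n f and c :: "nat \<Rightarrow> real"
  proof (induction n)
    case 0
    then show ?case using wedge_scale_right[of "one_form \<alpha>" 0 "\<lambda>_. 0" vs] by simp
  next
    case (Suc n)
    then show ?case
      using wedge_scale_right[of "one_form \<alpha>" "inverse (c n)" "f n" vs]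
      by (simp add: wedge_add_right divide_inverse mult.commute)
  qed
  let ?N = "Suc (length vs)"
  have "wedge (one_form \<alpha>) (exp_op B \<omega>) vs =
      wedge (one_form \<alpha>) (\<lambda>us. \<Sum>k<?N. (wedge B ^^ k) \<omega> us / fact k) vs"
    by (rule shrink) (simp add: exp_op_eq_sum[of _ ?N] del: sum.lessThan_Suc)
  then show ?thesis
    by (simp add: sum exp_op_eq_sum[of vs ?N] wedge_pow_one_form del: sum.lessThan_Suc)
qed

text \<open>Leibniz rule in each term, with k / k! = 1 / (k - 1)!. The index shift shortens the
  second sum by one term, so the proof starts from a truncation one longer than needed.\<close>

lemma interior_product_exp_op:
  "interior_product X (exp_op B \<omega>) vs =
    exp_op B (interior_product X \<omega>) vs + wedge (one_form (slot B X)) (exp_op B \<omega>) vs"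
proof -
  let ?N = "Suc (length vs)" and ?\<eta> = "wedge (one_form (slot B X)) \<omega>"
  have "interior_product X (exp_op B \<omega>) vs = (\<Sum>k<Suc ?N. interior_product X ((wedge B ^^ k) \<omega>) vs / fact k)"
    by (simp add: interior_product_def exp_op_eq_sum[of _ "Suc ?N"] del: sum.lessThan_Suc)
  also have "\<dots> = (\<Sum>k<Suc ?N. (wedge B ^^ k) (interior_product X \<omega>) vs / fact k) +
      (\<Sum>k<Suc ?N. real k * (wedge B ^^ (k - 1)) ?\<eta> vs / fact k)"
    unfolding interior_product_wedge_pow add_divide_distrib sum.distrib ..
  also have "(\<Sum>k<Suc ?N. real k * (wedge B ^^ (k - 1)) ?\<eta> vs / fact k) =
      (\<Sum>k<?N. (wedge B ^^ k) ?\<eta> vs / fact k)"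
    by (subst sum.lessThan_Suc_shift) (simp add: fact_reduce divide_simps del: sum.lessThan_Suc)
  finally show ?thesis
    by (simp add: exp_op_eq_sum[of vs "Suc ?N" "interior_product X \<omega>"] exp_op_eq_sum[of vs ?N ?\<eta>]
        exp_op_one_form[symmetric] del: sum.lessThan_Suc)
qed

lemma exp_op_add: "exp_op B (\<lambda>vs. \<omega> vs + \<eta> vs) vs = exp_op B \<omega> vs + exp_op B \<eta> vs"
proof -
  have "(wedge B ^^ k) (\<lambda>vs. \<omega> vs + \<eta> vs) = (\<lambda>vs. (wedge B ^^ k) \<omega> vs + (wedge B ^^ k) \<eta> vs)" for k
  proof (induction k)
    case (Suc k)
    then show ?case by (simp add: ext[OF wedge_add_right])
  qed simp
  then show ?thesis
    by (simp add: exp_op_eq_sum[of vs "Suc (length vs)"] sum.distrib add_divide_distrib del: sum.lessThan_Suc)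
qed

lemma two_form_uminus: "two_form \<B> (\<lambda>vs. - B vs)"
proof unfold_locales
  show "(\<lambda>vs. - B vs) \<in> forms_of_degree 2"
    using two_form by (auto simp: forms_of_degree_def forms_def linear_compose_neg)
qed

text \<open>Induction on the list of arguments: contracting with a vector, the terms with
  \<open>\<iota>\<^sub>X B\<close> coming from the two exponentials cancel.\<close>

lemma exp_op_inverse: "exp_op B (exp_op (\<lambda>vs. - B vs) \<omega>) vs = \<omega> vs"
proof (induction vs arbitrary: \<omega>)
  case Nil
  interpret neg: two_form \<B> "\<lambda>vs. - B vs" by (rule two_form_uminus)
  show ?case by (simp add: exp_op_Nil neg.exp_op_Nil)
next
  case (Cons X vs)
  interpret neg: two_form \<B> "\<lambda>vs. - B vs" by (rule two_form_uminus)
  let ?\<epsilon> = "exp_op (\<lambda>vs. - B vs)"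
  have uminus: "wedge (one_form (- \<alpha>)) \<eta> vs = - wedge (one_form \<alpha>) \<eta> vs" for \<alpha> \<eta> vs
  proof -
    have "one_form (- \<alpha>) = (\<lambda>vs. - one_form \<alpha> vs)"
      by (auto simp: one_form_def uminus_blinfun.rep_eq fun_eq_iff split: list.split)
    then show ?thesis by (simp add: wedge_minus_left)
  qed
  have "interior_product X (?\<epsilon> \<omega>) =
      (\<lambda>vs. ?\<epsilon> (interior_product X \<omega>) vs + wedge (one_form (- slot B X)) (?\<epsilon> \<omega>) vs)"
    by (rule ext) (simp add: neg.interior_product_exp_op slot_uminus form)
  then have "exp_op B (interior_product X (?\<epsilon> \<omega>)) vs =
      interior_product X \<omega> vs - wedge (one_form (slot B X)) (exp_op B (?\<epsilon> \<omega>)) vs"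
    by (simp add: exp_op_add Cons exp_op_one_form) (simp add: uminus)
  then have "interior_product X (exp_op B (?\<epsilon> \<omega>)) vs = interior_product X \<omega> vs"
    by (simp add: interior_product_exp_op)
  then show ?case by (simp add: interior_product_def)
qed

text \<open>The covector part commutes with the exponentials, and moving the contraction past e^(-B)
  leaves -\<iota>_X B. From here on conjugation is a shear of the generalized tangent space.\<close>

lemma Ad_op_gvector_op:
  "Ad_op B (gvector_op y) \<omega> = gvector_op (fst y, snd y - slot B (fst y)) \<omega>"
proof
  interpret neg: two_form \<B> "\<lambda>vs. - B vs" by (rule two_form_uminus)
  let ?\<epsilon> = "exp_op (\<lambda>vs. - B vs)"
  fix vs
  have diff: "one_form (snd y - slot B (fst y)) = (\<lambda>vs. one_form (snd y) vs + one_form (- slot B (fst y)) vs)"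
    by (auto simp: one_form_def minus_blinfun.rep_eq uminus_blinfun.rep_eq fun_eq_iff split: list.split)
  have "exp_op B (?\<epsilon> \<omega>) = \<omega>" for \<omega> :: "'e form"
    by (rule ext) (rule exp_op_inverse)
  moreover have "interior_product (fst y) (?\<epsilon> \<omega>) =
      (\<lambda>vs. ?\<epsilon> (interior_product (fst y) \<omega>) vs + wedge (one_form (- slot B (fst y))) (?\<epsilon> \<omega>) vs)"
    by (rule ext) (simp add: neg.interior_product_exp_op slot_uminus form)
  ultimately show "Ad_op B (gvector_op y) \<omega> vs = gvector_op (fst y, snd y - slot B (fst y)) \<omega> vs"
    by (simp add: Ad_op_def gvector_op_def exp_op_add exp_op_one_form diff wedge_add_left)
qed

end

text \<open>Two kinds of test forms suffice: on the constant form 1 only the covector part acts, and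
  a one-form evaluated at the empty list sees only the vector part. Needed because
  \<open>Ad_image\<close> compares operators, not elements.\<close>

lemma (in orthonormal_basis) gvector_op_inject:
  fixes x y :: "'e gvector"
  assumes "\<And>\<omega>. \<omega> \<in> forms \<Longrightarrow> gvector_op x \<omega> = gvector_op y \<omega>"
  shows "x = y"
proof -
  have one: "(\<lambda>vs::'e list. if vs = [] then 1 else 0) \<in> forms"
    by (auto simp: forms_def linear_zero[unfolded module_hom_def] intro!: linearI)
  have "blinfun_apply (snd x) v = blinfun_apply (snd y) v" for v
    using fun_cong[OF assms[OF one], of "[v]"]
    by (simp add: gvector_op_def interior_product_def wedge_one_form_Cons del: wedge.simps)
      (simp add: one_form_def interior_product_def)
  then have "snd x = snd y" by (rule blinfun_eqI)
  moreover have "inner (fst x) b = inner (fst y) b" for b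
  proof -
    have "one_form (blinfun_inner_left b) \<in> forms"
    proof -
      have "one_form \<alpha> (us @ v # vs) = (if us = [] \<and> vs = [] then blinfun_apply \<alpha> v else 0)"
        for \<alpha> :: "'e covector" and us vs v
        by (cases us) (auto simp: one_form_def split: list.split)
      then have eq: "(\<lambda>v. one_form \<alpha> (us @ v # vs)) =
          (if us = [] \<and> vs = [] then blinfun_apply \<alpha> else (\<lambda>v. 0))" for \<alpha> :: "'e covector" and us vs
        by auto
      have "linear (\<lambda>v. one_form \<alpha> (us @ v # vs))" for \<alpha> :: "'e covector" and us vs
        unfolding eq by (simp add: linear_zero bounded_linear.linear[OF blinfun.bounded_linear_right])
      moreover have "one_form \<alpha> (us @ v # vs @ v # ws) = 0" for \<alpha> :: "'e covector" and us vs ws v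
        by (cases us) (auto simp: one_form_def split: list.split)
      ultimately show ?thesis by (auto simp: forms_def)
    qed
    from fun_cong[OF assms[OF this], of "[]"] show ?thesis
      by (simp add: gvector_op_def interior_product_def one_form_def inner_commute)
  qed
  then have "fst x = fst y" using vector_eq_rdot by blast
  ultimately show ?thesis by (simp add: prod_eq_iff)
qed

lemma (in two_form) Ad_image_eq:
  "Ad_image B S = (\<lambda>y. (fst y, snd y - slot B (fst y))) ` S"
  unfolding Ad_image_def Ad_op_gvector_op using gvector_op_inject by blast

section \<open>Linear algebra of a split structure at a point\<close>

text \<open>Opens the dimension theory of \<open>finite_dimensional_vector_space\<close> to types
  known only to have a finite spanning set.\<close>

lemma finite_dimensional_interpretation:
  fixes S :: "'v::real_vector set"
  assumes "finite S" "span S = UNIV"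
  shows "\<exists>B. finite_dimensional_vector_space (scaleR :: real \<Rightarrow> 'v \<Rightarrow> 'v) B"
proof -
  obtain B where B: "B \<subseteq> S" "independent B" "S \<subseteq> span B"
    using maximal_independent_subset[of S] by blast
  then have "span B = UNIV" using assms(2) by (metis span_mono span_span top.extremum_uniqueI)
  moreover have "finite B" using B(1) assms(1) finite_subset by blast
  ultimately show ?thesis using B(2)
    by (intro exI[of _ B] finite_dimensional_vector_space.intro
        finite_dimensional_vector_space_axioms.intro real_vector.vector_space_axioms)
      (auto simp: dependent_raw_def span_raw_def)
qed

lemma finite_dimensional_facts:
  fixes S T :: "'v::real_vector set"
  assumes fin: "finite D" "span D = (UNIV :: 'v set)" and S: "subspace S" and T: "subspace T"
  shows subspace_eqI_dim: "S \<subseteq> T \<Longrightarrow> dim T \<le> dim S \<Longrightarrow> S = T"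
    and subspace_dim_sum: "S \<inter> T = {0} \<Longrightarrow> dim {x + y | x y. x \<in> S \<and> y \<in> T} = dim S + dim T"
    and subspace_dim_image: "linear f \<Longrightarrow> inj_on f S \<Longrightarrow> dim (f ` S) = dim S"
proof -
  obtain B where "finite_dimensional_vector_space (scaleR :: real \<Rightarrow> 'v \<Rightarrow> 'v) B"
    using finite_dimensional_interpretation[OF fin] by blast
  then interpret V: finite_dimensional_vector_space "scaleR :: real \<Rightarrow> 'v \<Rightarrow> 'v" B
    rewrites "module.subspace (*\<^sub>R) = subspace" and "vector_space.dim (*\<^sub>R) = dim"
      and "module.span (*\<^sub>R) = span"
    by (simp_all add: subspace_raw_def dim_raw_def span_raw_def)
  show "S \<subseteq> T \<Longrightarrow> dim T \<le> dim S \<Longrightarrow> S = T"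
    by (rule V.subspace_dim_equal[OF S T])
  show "S \<inter> T = {0} \<Longrightarrow> dim {x + y | x y. x \<in> S \<and> y \<in> T} = dim S + dim T"
    using V.dim_sums_Int[OF S T] by simp
  interpret finite_dimensional_vector_space_pair_1 "scaleR :: real \<Rightarrow> 'v \<Rightarrow> 'v" B
      "scaleR :: real \<Rightarrow> 'w \<Rightarrow> 'w::real_vector" ..
  have span: "span S = S" by (rule span_eq_iff[THEN iffD2, OF S])
  show "linear f \<Longrightarrow> inj_on f S \<Longrightarrow> dim (f ` S) = dim S"
    using dim_image_eq[of f S, unfolded span] by (simp add: linear_def dim_raw_def)
qed

lemma gbracket_commute: "gbracket x y = gbracket y x"
  by (simp add: gbracket_def)

lemma gbracket_linear_right: "linear (gbracket x)"
  by (auto intro!: linearI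
      simp: gbracket_def blinfun.add_left blinfun.add_right blinfun.scaleR_left blinfun.scaleR_right algebra_simps)

lemmas gbracket_simps =
  linear_add[OF gbracket_linear_right] linear_diff[OF gbracket_linear_right]
  linear_scale[OF gbracket_linear_right] linear_sum[OF gbracket_linear_right]
  linear_0[OF gbracket_linear_right] linear_neg[OF gbracket_linear_right]

lemma gbracket_diff_left: "gbracket (x - y) z = gbracket x z - gbracket y z"
  by (simp add: gbracket_commute[of _ z] gbracket_simps)

lemma gbracket_covector: "gbracket x (0, \<alpha>) = blinfun_apply \<alpha> (fst x)"
  by (simp add: gbracket_def)

lemma gbracket_vector: "gbracket x (v, 0) = blinfun_apply (snd x) v"
  by (simp add: gbracket_def)

lemma orth_iff: "y \<in> orth E p \<longleftrightarrow> (\<forall>x\<in>E p. gbracket x y = 0)"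
  by (simp add: orth_def pairing_def)

lemma cotangent_iff: "z \<in> cotangent \<longleftrightarrow> fst z = 0"
  by (cases z) (simp add: cotangent_def)

lemma subspace_orth: "subspace (orth E p)"
  by (simp add: subspace_def orth_iff gbracket_simps)

lemma gbracket_nondegenerate:
  fixes z :: "'e::real_inner gvector"
  assumes "\<And>w. gbracket w z = 0"
  shows "z = 0"
proof -
  have "inner (fst z) (fst z) = 0"
    using assms[of "(0, blinfun_inner_left (fst z))"] by (simp add: gbracket_def)
  then have "fst z = 0" by simp
  moreover have "blinfun_apply (snd z) v = blinfun_apply 0 v" for v
    using assms[of "(v, 0)"] by (simp add: gbracket_def)
  then have "snd z = 0" by (rule blinfun_eqI)
  ultimately show ?thesis by (simp add: prod_eq_iff)
qed

section \<open>Riesz representation and orthogonal projection in the model space\<close>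

context orthonormal_basis
begin

lemma covector_riesz: "\<exists>v. \<alpha> = blinfun_inner_left v"
  for \<alpha> :: "'e covector"
proof -
  define w where "w = (\<Sum>b\<in>\<B>. blinfun_apply \<alpha> b *\<^sub>R b)"
  have "blinfun_apply \<alpha> x = inner w x" for x
    using linear_expand[OF bounded_linear.linear[OF blinfun.bounded_linear_right], of \<alpha> x]
    by (simp add: w_def inner_sum_left inner_commute[of x] mult.commute)
  then have "\<alpha> = blinfun_inner_left w"
    by (intro blinfun_eqI) (simp add: inner_commute[of w])
  then show ?thesis by blast
qed

lemma orthogonal_decomposition:
  fixes F :: "'e set"
  assumes "subspace F"
  shows "\<exists>y\<in>F. \<forall>z\<in>F. inner (x - y) z = 0"
proof -
  obtain C where C: "C \<subseteq> F" "independent C" "F \<subseteq> span C"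
    using maximal_independent_subset[of F] by blast
  have "finite C"
  proof (rule independent_span_bound[THEN conjunct1])
    show "finite \<B>" "independent C" "C \<subseteq> span \<B>" using finite_basis C(2) span_basis by auto
  qed
  then obtain O' where O': "finite O'" "span O' = span C" "pairwise real_inner_class.orthogonal O'"
    using basis_orthogonal by metis
  have F: "span O' = F"
    using O' C assms by (metis span_minimal subset_antisym)
  let ?y = "\<Sum>u\<in>O'. (inner x u / inner u u) *\<^sub>R u"
  have "inner (x - ?y) u = 0" if "u \<in> O'" for u
  proof -
    have "inner ?y u = (\<Sum>w\<in>O'. if w = u then inner x u else 0)"
      unfolding inner_sum_left
    proof (intro sum.cong refl)
      fix w assume "w \<in> O'"
      show "inner ((inner x w / inner w w) *\<^sub>R w) u = (if w = u then inner x u else 0)"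
        using O'(3) that \<open>w \<in> O'\<close> by (auto simp: pairwise_def real_inner_class.orthogonal_def)
    qed
    then show ?thesis using that O'(1) by (simp add: inner_diff_left)
  qed
  then have "real_inner_class.orthogonal (x - ?y) z" if "z \<in> F" for z
    using that F by (intro orthogonal_to_span[of z O']) (auto simp: real_inner_class.orthogonal_def)
  moreover have "?y \<in> F" unfolding F[symmetric] by (intro span_sum span_scale span_base)
  ultimately show ?thesis by (auto simp: real_inner_class.orthogonal_def)
qed

lemma finite_dimensional_gvector: "\<exists>D::'e gvector set. finite D \<and> span D = UNIV"
proof (intro exI conjI)
  let ?D = "(\<lambda>b. (b, 0)) ` \<B> \<union> (\<lambda>b. (0, blinfun_inner_left b)) ` \<B> :: 'e gvector set"
  show "finite ?D" using finite_basis by simp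
  have "(v, 0) \<in> span ?D" for v
  proof -
    have "(\<Sum>b\<in>\<B>. inner v b *\<^sub>R (b, 0)) = ((v, 0) :: 'e gvector)"
      using expand[of v] by (simp add: prod_eq_iff fst_sum snd_sum)
    moreover have "(\<Sum>b\<in>\<B>. inner v b *\<^sub>R (b, 0)) \<in> span ?D"
      by (intro span_sum span_scale span_base) auto
    ultimately show ?thesis by simp
  qed
  moreover have "(0, blinfun_inner_left v) \<in> span ?D" for v
  proof -
    have "inner w v = (\<Sum>b\<in>\<B>. inner v b * inner w b)" for w
      using arg_cong[OF expand[of v], of "inner w"] by (simp add: inner_sum_right)
    then have "(\<Sum>b\<in>\<B>. inner v b *\<^sub>R blinfun_inner_left b) = blinfun_inner_left v"
      by (intro blinfun_eqI) (simp add: blinfun.sum_left blinfun.scaleR_left)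
    then have "(\<Sum>b\<in>\<B>. inner v b *\<^sub>R (0, blinfun_inner_left b)) = ((0, blinfun_inner_left v) :: 'e gvector)"
      by (simp add: prod_eq_iff fst_sum snd_sum)
    moreover have "(\<Sum>b\<in>\<B>. inner v b *\<^sub>R (0, blinfun_inner_left b)) \<in> span ?D"
      by (intro span_sum span_scale span_base) auto
    ultimately show ?thesis by simp
  qed
  ultimately have "(v, 0) + (0, \<alpha>) \<in> span ?D" for v and \<alpha> :: "'e covector"
    using covector_riesz[of \<alpha>] by (metis span_add)
  then show "span ?D = UNIV" by auto
qed

end

text \<open>The data of a split structure at one point, with a frame of the fibre. The whole family
  E remains a parameter so that \<open>orth\<close> and \<open>pr\<close> apply unchanged.\<close>

locale split_point = orthonormal_basis \<B> for \<B> :: "'e::real_inner set" +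
  fixes E :: "'m \<Rightarrow> 'e gvector set" and p :: 'm and k :: nat and s :: "nat \<Rightarrow> 'e gvector"
  assumes nondegenerate: "nondegenerate_on pairing (E p)"
    and linindep: "linindep k s" and span_frame: "span (s ` {..<k}) = E p"
begin

abbreviation P :: "'e gvector \<Rightarrow> 'e gvector" where "P \<equiv> pr E p"

lemma subspace_E: "subspace (E p)"
  using span_frame subspace_span by metis

text \<open>A kernel vector of the Gram matrix is the coefficient vector of an element of the fibre
  orthogonal to the whole fibre.\<close>

lemma mdet_frame: "mdet k (\<lambda>i j. gbracket (s i) (s j)) \<noteq> 0"
  unfolding mdet_nonzero_iff
proof (intro allI impI)
  fix c j assume c: "\<forall>i<k. (\<Sum>j<k. gbracket (s i) (s j) * c j) = 0" and "j < k"
  let ?x = "\<Sum>j<k. c j *\<^sub>R s j"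
  have x: "?x \<in> E p" unfolding span_frame[symmetric] span_image_lessThan by blast
  have "gbracket ?x (s i) = 0" if "i < k" for i
    using c that by (simp add: gbracket_commute[of _ "s i"] gbracket_simps mult.commute)
  then have "pairing ?x y = 0" if "y \<in> E p" for y
    using that unfolding span_frame[symmetric] span_image_lessThan
    by (auto simp: pairing_def gbracket_simps)
  then have "?x = 0" using nondegenerate x by (auto simp: nondegenerate_on_def)
  then show "c j = 0" using linindep \<open>j < k\<close> by (auto simp: linindep_def)
qed

lemma orth_frameI: "(\<And>i. i < k \<Longrightarrow> gbracket (s i) y = 0) \<Longrightarrow> y \<in> orth E p"
  unfolding orth_iff span_frame[symmetric] span_image_lessThan
  by (auto simp: gbracket_commute[of _ y] gbracket_simps)

lemma E_inter_orth: "z \<in> E p \<Longrightarrow> z \<in> orth E p \<Longrightarrow> z = 0"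
  using nondegenerate by (auto simp: nondegenerate_on_def orth_def pairing_def gbracket_commute)

text \<open>Evaluates the definite description in \<open>pr\<close>: two candidates differ by an
  element of E that is orthogonal to E.\<close>

lemma pr_unique:
  assumes "e \<in> E p" "z - e \<in> orth E p" shows "P z = e"
  unfolding pr_def
proof (rule the_equality)
  fix e' assume e': "e' \<in> E p \<and> z - e' \<in> orth E p"
  have "(z - e) - (z - e') \<in> orth E p" using assms e'
    by (intro subspace_diff[OF subspace_orth, of "z - e"]) auto
  moreover have "e' - e \<in> E p" using assms e'
    by (intro subspace_diff[OF subspace_E]) auto
  ultimately have "e' - e = 0" by (intro E_inter_orth) auto
  then show "e' = e" by simp
qed (use assms in auto)

text \<open>Existence of the projection, in the form of the usual formula with the inverse Gram
  matrix, from which smoothness in the base point can later be read off.\<close>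

lemma frame_projection:
  fixes z :: "'e gvector"
  defines "e \<equiv> \<Sum>i<k. (\<Sum>j<k. minv k (\<lambda>i j. gbracket (s i) (s j)) i j * gbracket (s j) z) *\<^sub>R s i"
  shows "e \<in> E p" "z - e \<in> orth E p"
proof -
  let ?G = "\<lambda>i j. gbracket (s i) (s j)"
  show "e \<in> E p"
    unfolding e_def span_frame[symmetric] by (intro span_sum span_scale span_base) auto
  show "z - e \<in> orth E p"
  proof (rule orth_frameI)
    fix l assume l: "l < k"
    have "gbracket (s l) e = (\<Sum>i<k. \<Sum>j<k. ?G l i * minv k ?G i j * gbracket (s j) z)"
      unfolding e_def linear_sum[OF gbracket_linear_right] linear_scale[OF gbracket_linear_right]
      by (intro sum.cong refl) (simp add: sum_distrib_left sum_distrib_right mult_ac)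
    also have "\<dots> = (\<Sum>j<k. (\<Sum>i<k. ?G l i * minv k ?G i j) * gbracket (s j) z)"
      by (subst sum.swap) (simp add: sum_distrib_right)
    also have "\<dots> = (\<Sum>j<k. if l = j then gbracket (s j) z else 0)"
      using l by (intro sum.cong) (auto simp: minv_right[OF mdet_frame])
    also have "\<dots> = gbracket (s l) z" using l by simp
    finally show "gbracket (s l) (z - e) = 0" by (simp add: gbracket_simps)
  qed
qed

lemmas pr_frame = pr_unique[OF frame_projection]

lemma pr_mem: "P z \<in> E p" and pr_diff_mem: "z - P z \<in> orth E p"
  using frame_projection[of z] by (simp_all add: pr_frame)

lemma pr_E: "z \<in> E p \<Longrightarrow> P z = z"
  by (rule pr_unique) (auto simp: subspace_0[OF subspace_orth])

lemma pr_orth: "z \<in> orth E p \<Longrightarrow> P z = 0"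
  by (rule pr_unique) (auto simp: subspace_0[OF subspace_E])

lemma linear_pr: "linear P"
proof (rule linearI)
  show "P (x + y) = P x + P y" for x y
  proof (rule pr_unique)
    show "x + y - (P x + P y) \<in> orth E p"
      using subspace_add[OF subspace_orth pr_diff_mem[of x] pr_diff_mem[of y]] by (simp add: algebra_simps)
  qed (intro subspace_add subspace_E pr_mem)
  show "P (c *\<^sub>R x) = c *\<^sub>R P x" for c x
  proof (rule pr_unique)
    show "c *\<^sub>R x - c *\<^sub>R P x \<in> orth E p"
      using subspace_scale[OF subspace_orth pr_diff_mem[of x], of c] by (simp add: algebra_simps)
  qed (intro subspace_scale subspace_E pr_mem)
qed

lemma gbracket_E_orth: "x \<in> E p \<Longrightarrow> y \<in> orth E p \<Longrightarrow> gbracket x y = 0"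
  by (simp add: orth_iff)

lemma gbracket_pr_pr: "gbracket (P x) (P y) = gbracket (P x) y"
  using gbracket_E_orth[OF pr_mem[of x] pr_diff_mem[of y]] by (simp add: gbracket_simps)

text \<open>The defect z - P z is orthogonal to E and to the complement of E, and every w splits as
  P w + (w - P w); nondegeneracy of the full bracket then makes the defect 0.\<close>

lemma orth_orth:
  assumes "\<And>y. y \<in> orth E p \<Longrightarrow> gbracket y z = 0" shows "z \<in> E p"
proof -
  have "gbracket w (z - P z) = 0" for w
  proof -
    have "gbracket (P w) (z - P z) = 0" by (intro gbracket_E_orth pr_mem pr_diff_mem)
    moreover have "gbracket (w - P w) (z - P z) = 0"
      using assms[OF pr_diff_mem] gbracket_E_orth[OF pr_mem pr_diff_mem]
      by (simp add: gbracket_simps gbracket_commute[of "w - P w" "P z"])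
    ultimately show ?thesis by (simp add: gbracket_diff_left)
  qed
  then have "z - P z = 0" by (rule gbracket_nondegenerate)
  then show ?thesis using pr_mem[of z] by simp
qed

lemma annihilator_E_iff: "\<alpha> \<in> annihilator (fst ` E p) \<longleftrightarrow> (0, \<alpha>) \<in> orth E p"
  by (auto simp: annihilator_def orth_iff gbracket_covector)

text \<open>A covector that kills the vector parts of the complement is orthogonal to the
  complement, so the double complement puts it in E.\<close>

lemma annihilator_orth_iff: "\<alpha> \<in> annihilator (fst ` orth E p) \<longleftrightarrow> (0, \<alpha>) \<in> E p"
proof
  assume "\<alpha> \<in> annihilator (fst ` orth E p)"
  then show "(0, \<alpha>) \<in> E p"
    by (intro orth_orth) (auto simp: annihilator_def gbracket_covector)
next
  assume "(0, \<alpha>) \<in> E p"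
  then show "\<alpha> \<in> annihilator (fst ` orth E p)"
    by (auto simp: annihilator_def orth_iff gbracket_def image_iff) force
qed

section \<open>Pointwise equivalents of the conditions\<close>

definition preserves_cotangent :: bool where
  "preserves_cotangent \<longleftrightarrow> (\<forall>\<alpha>. fst (P (0, \<alpha>)) = 0)"

lemma preserves_cotangent_iff_decomposition:
  "preserves_cotangent \<longleftrightarrow> direct_sum_decomposition cotangent (cotangent \<inter> E p) (cotangent \<inter> orth E p)"
proof
  assume pc: preserves_cotangent
  have "subspace (cotangent :: 'e gvector set)"
    by (auto simp: cotangent_iff subspace_def)
  moreover have "(cotangent \<inter> E p) \<inter> (cotangent \<inter> orth E p) = {0}"
    using E_inter_orth subspace_0[OF subspace_E] subspace_0[OF subspace_orth[of E p]]
    by (auto simp: cotangent_iff)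
  moreover have "cotangent = {x + y | x y. x \<in> cotangent \<inter> E p \<and> y \<in> cotangent \<inter> orth E p}"
  proof (intro subset_antisym subsetI)
    fix z :: "'e gvector" assume z: "z \<in> cotangent"
    then have "P z \<in> cotangent" using pc
      by (cases z) (auto simp: cotangent_iff preserves_cotangent_def)
    moreover from this have "z - P z \<in> cotangent" using z by (auto simp: cotangent_def)
    moreover have "z = P z + (z - P z)" by simp
    ultimately show "z \<in> {x + y | x y. x \<in> cotangent \<inter> E p \<and> y \<in> cotangent \<inter> orth E p}"
      using pr_mem pr_diff_mem by blast
  qed (auto simp: cotangent_def)
  ultimately show "direct_sum_decomposition cotangent (cotangent \<inter> E p) (cotangent \<inter> orth E p)"
    unfolding direct_sum_decomposition_def
    by - (intro conjI subspace_inter subspace_E subspace_orth; assumption)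
next
  assume d: "direct_sum_decomposition cotangent (cotangent \<inter> E p) (cotangent \<inter> orth E p)"
  show preserves_cotangent
    unfolding preserves_cotangent_def
  proof
    fix \<alpha> :: "'e covector"
    have "(0, \<alpha>) \<in> cotangent" by (simp add: cotangent_def)
    then obtain x y where xy: "(0, \<alpha>) = x + y" "x \<in> cotangent" "x \<in> E p" "y \<in> orth E p"
      using d unfolding direct_sum_decomposition_def by blast
    then have "P (0, \<alpha>) = x" by (intro pr_unique) (auto simp: algebra_simps)
    then show "fst (P (0, \<alpha>)) = 0" using xy by (auto simp: cotangent_def)
  qed
qed

text \<open>With X the vector part of P(0, \<alpha>), the bracket with P(0, \<beta>) is \<beta>(X);
  the covector dual to X itself gives the squared norm of X.\<close>

lemma preserves_cotangent_iff_isotropic: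
  "preserves_cotangent \<longleftrightarrow> (\<forall>\<alpha> \<beta>. gbracket (P (0, \<alpha>)) (P (0, \<beta>)) = 0)"
proof
  assume *: "\<forall>\<alpha> \<beta>. gbracket (P (0, \<alpha>)) (P (0, \<beta>)) = 0"
  show preserves_cotangent
    unfolding preserves_cotangent_def
  proof
    fix \<alpha>
    have "inner (fst (P (0, \<alpha>))) (fst (P (0, \<alpha>))) = 0"
      using *[rule_format, of \<alpha> "blinfun_inner_left (fst (P (0, \<alpha>)))"]
      by (simp add: gbracket_pr_pr gbracket_covector)
    then show "fst (P (0, \<alpha>)) = 0" by simp
  qed
qed (simp add: preserves_cotangent_def gbracket_def)

text \<open>The images of E and of its complement always span; only directness of the sum is at
  stake in condition 3).\<close>

lemma sum_projections: "\<exists>x\<in>fst ` E p. \<exists>y\<in>fst ` orth E p. v = x + y"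
proof -
  have "v = fst (P (v, 0)) + fst ((v, 0) - P (v, 0))" by simp
  then show ?thesis using pr_mem pr_diff_mem by blast
qed

lemma preserves_cotangent_iff_inter:
  "preserves_cotangent \<longleftrightarrow> fst ` E p \<inter> fst ` orth E p = {0}"
proof
  assume pc: preserves_cotangent
  have "x = 0" if x: "x \<in> fst ` E p" "x \<in> fst ` orth E p" for x
  proof -
    let ?\<alpha> = "blinfun_inner_left x"
    have "P (0, ?\<alpha>) = (0, snd (P (0, ?\<alpha>)))"
      using pc by (simp add: prod_eq_iff preserves_cotangent_def)
    then have 1: "snd (P (0, ?\<alpha>)) \<in> annihilator (fst ` orth E p)"
      using pr_mem[of "(0, ?\<alpha>)"] by (simp add: annihilator_orth_iff)
    have "(0, ?\<alpha>) - P (0, ?\<alpha>) = (0, ?\<alpha> - snd (P (0, ?\<alpha>)))"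
      using pc by (simp add: prod_eq_iff preserves_cotangent_def)
    then have 2: "?\<alpha> - snd (P (0, ?\<alpha>)) \<in> annihilator (fst ` E p)"
      using pr_diff_mem[of "(0, ?\<alpha>)"] by (simp add: annihilator_E_iff)
    have "blinfun_apply (snd (P (0, ?\<alpha>))) x = 0" "blinfun_apply (?\<alpha> - snd (P (0, ?\<alpha>))) x = 0"
      using 1 2 x unfolding annihilator_def by blast+
    then have "blinfun_apply ?\<alpha> x = 0" by (simp add: blinfun.diff_left)
    then show "x = 0" by simp
  qed
  moreover have "0 \<in> fst ` E p" "0 \<in> fst ` orth E p"
    using subspace_0[OF subspace_E] subspace_0[OF subspace_orth[of E p]] by (force simp: zero_prod_def)+
  ultimately show "fst ` E p \<inter> fst ` orth E p = {0}" by blast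
next
  assume *: "fst ` E p \<inter> fst ` orth E p = {0}"
  show preserves_cotangent
    unfolding preserves_cotangent_def
  proof
    fix \<alpha>
    have "fst (P (0, \<alpha>)) = fst (- ((0, \<alpha>) - P (0, \<alpha>)))" by simp
    moreover have "- ((0, \<alpha>) - P (0, \<alpha>)) \<in> orth E p"
      using subspace_neg[OF subspace_orth pr_diff_mem] by blast
    ultimately have "fst (P (0, \<alpha>)) \<in> fst ` E p \<inter> fst ` orth E p"
      using pr_mem by (metis IntI image_eqI)
    then show "fst (P (0, \<alpha>)) = 0" using * by simp
  qed
qed

lemma subspace_projections: "subspace (fst ` E p)" "subspace (fst ` orth E p)"
  by (intro linear_subspace_image linear_fst subspace_E subspace_orth)+

text \<open>\<open>P\<close> restricted to the covectors dual to \<open>\<pi>(E)\<close> is a bijection onto \<open>P(T\<^sup>*)\<close>, which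
  contains \<open>E \<inter> T\<^sup>*\<close>, the kernel of \<open>\<pi>\<close> on \<open>E\<close>.\<close>

lemma preserves_cotangent_iff_dim:
  assumes "k = 2 * r"
  shows "preserves_cotangent \<longleftrightarrow> dim (fst ` E p) = r"
proof -
  let ?T = "cotangent :: 'e gvector set" and ?F = "fst ` E p"
  let ?flat = "\<lambda>v. P (0, blinfun_inner_left v)"
  obtain D :: "'e gvector set" where D: "finite D" "span D = UNIV"
    using finite_dimensional_gvector by blast
  have subT: "subspace ?T" by (auto simp: cotangent_iff subspace_def)
  have flat_lin: "linear ?flat"
  proof -
    have "linear (\<lambda>v. (0, blinfun_inner_left v) :: 'e gvector)"
      by (intro linearI) (auto intro!: blinfun_eqI
          simp: blinfun.add_left blinfun.scaleR_left inner_add_right)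
    then show ?thesis using linear_compose[OF _ linear_pr] by (simp add: o_def)
  qed
  have flat_image: "?flat ` ?F = P ` ?T"
  proof (intro subset_antisym subsetI)
    fix z assume "z \<in> P ` ?T"
    then obtain \<alpha> where z: "z = P (0, \<alpha>)" by (auto simp: cotangent_def)
    obtain v where v: "\<alpha> = blinfun_inner_left v" using covector_riesz by blast
    obtain y where y: "y \<in> ?F" "\<And>z. z \<in> ?F \<Longrightarrow> inner (v - y) z = 0"
      using orthogonal_decomposition[OF subspace_projections(1)] by blast
    \<comment> \<open>The component of v orthogonal to F gives a covector in Ann(F), which lies in
      the complement of E and is killed by P; only the component y in F matters.\<close>
    have "blinfun_inner_left (v - y) \<in> annihilator ?F"
      using y(2) by (simp add: annihilator_def inner_commute[of _ "v - y"])
    then have "P (0, blinfun_inner_left (v - y)) = 0" by (simp add: annihilator_E_iff pr_orth)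
    then have "?flat v - ?flat y = 0" by (simp add: linear_diff[OF flat_lin])
    then show "z \<in> ?flat ` ?F" using y(1) by (auto simp: z v)
  qed (auto simp: cotangent_def)
  have flat_inj: "inj_on ?flat ?F"
  proof (subst linear_inj_on_iff_eq_0[OF flat_lin subspace_projections(1)], intro ballI impI)
    \<comment> \<open>A dual covector killed by P lies in Ann(F), so it vanishes on the vector v of
      F to which it is dual.\<close>
    fix v assume v: "v \<in> ?F" "?flat v = 0"
    then have "(0, blinfun_inner_left v) \<in> orth E p" using pr_diff_mem[of "(0, blinfun_inner_left v)"] by simp
    then have "blinfun_apply (blinfun_inner_left v) v = 0"
      using v(1) unfolding annihilator_E_iff[symmetric] annihilator_def by blast
    then show "v = 0" by simp
  qed
  have dimP: "dim (P ` ?T) = dim ?F"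
    unfolding flat_image[symmetric]
    by (rule subspace_dim_image[OF finite_basis span_basis subspace_projections(1)
          subspace_projections(1) flat_lin flat_inj])
  have dimE: "dim (E p) = dim (E p \<inter> ?T) + dim ?F"
  proof -
    \<comment> \<open>A linear section of the projection of E onto F; its image is a complement of
      the kernel.\<close>
    obtain g where g: "g ` UNIV \<subseteq> E p" "linear g" "\<forall>v\<in>?F. fst (g v) = v"
      using linear_exists_right_inverse_on[OF linear_fst subspace_E] by blast
    have g_inj: "inj_on g ?F" using g(3) by (metis inj_onI)
    have "E p = {x + y | x y. x \<in> E p \<inter> ?T \<and> y \<in> g ` ?F}"
    proof (intro subset_antisym subsetI)
      fix z assume z: "z \<in> E p"
      have "z - g (fst z) \<in> E p" using z g(1) by (intro subspace_diff[OF subspace_E]) auto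
      moreover have "fst (z - g (fst z)) = 0" using z g(3) by auto
      then have "z - g (fst z) \<in> ?T" by (cases "z - g (fst z)") (auto simp: cotangent_def)
      moreover have "z = (z - g (fst z)) + g (fst z)" by simp
      ultimately show "z \<in> {x + y | x y. x \<in> E p \<inter> ?T \<and> y \<in> g ` ?F}" using z by blast
    next
      fix z assume "z \<in> {x + y | x y. x \<in> E p \<inter> ?T \<and> y \<in> g ` ?F}"
      then show "z \<in> E p" using g(1) subspace_add[OF subspace_E] by blast
    qed
    moreover have "(E p \<inter> ?T) \<inter> g ` ?F = {0}"
    proof -
      have "z = 0" if z: "z \<in> ?T" "z \<in> g ` ?F" for z
      proof -
        obtain v where v: "v \<in> ?F" "z = g v" using z by blast
        then have "v = 0" using z(1) g(3) by (auto simp: cotangent_def)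
        then show ?thesis using v linear_0[OF g(2)] by simp
      qed
      moreover have "0 \<in> g ` ?F"
        using linear_0[OF g(2)] subspace_0[OF subspace_projections(1)] by (metis image_eqI)
      moreover have "0 \<in> ?T" by (simp add: cotangent_iff)
      ultimately show ?thesis using subspace_0[OF subspace_E] by blast
    qed
    ultimately have "dim (E p) = dim (E p \<inter> ?T) + dim (g ` ?F)"
      using subspace_dim_sum[OF D subspace_inter[OF subspace_E subT]
          linear_subspace_image[OF g(2) subspace_projections(1)]] by simp
    also have "dim (g ` ?F) = dim ?F"
      by (rule subspace_dim_image[OF finite_basis span_basis subspace_projections(1)
            subspace_projections(1) g(2) g_inj])
    finally show ?thesis .
  qed
  have "dim (E p) = 2 * r"
  proof -
    have "dim (E p) = card (s ` {..<k})"
      unfolding span_frame[symmetric]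
      using linindep[unfolded linindep_iff] by (intro dim_span_eq_card_independent) auto
    then show ?thesis using linindep[unfolded linindep_iff] assms by (simp add: card_image)
  qed
  note dim = this dimE dimP
  have sub: "E p \<inter> ?T \<subseteq> P ` ?T" using pr_E by force
  have subs: "subspace (E p \<inter> ?T)" "subspace (P ` ?T)"
    by (intro subspace_inter linear_subspace_image linear_pr subspace_E subT)+
  show ?thesis
  proof
    assume preserves_cotangent
    then have "P ` ?T \<subseteq> E p \<inter> ?T"
      using pr_mem by (auto simp: cotangent_iff preserves_cotangent_def)
    then have "P ` ?T = E p \<inter> ?T" using sub by blast
    then show "dim ?F = r" using dim by simp
  next
    assume "dim ?F = r"
    then have "E p \<inter> ?T = P ` ?T"
      using subspace_eqI_dim[OF D subs sub] dim by simp
    then show preserves_cotangent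
      by (auto simp: cotangent_iff preserves_cotangent_def)
  qed
qed

end

text \<open>With \<open>P(u, 0) = (X\<^sub>u, \<xi>\<^sub>u)\<close> this is \<open>B(u, v) = \<xi>\<^sub>u(v - 2 X\<^sub>v)\<close>.  When \<open>P\<close> preserves \<open>T\<^sup>*\<close>,
  it is the 2-form that vanishes on \<open>\<pi>(E) \<times> \<pi>(E)\<close> and on \<open>\<pi>(E\<^sup>\<bottom>) \<times> \<pi>(E\<^sup>\<bottom>)\<close> and equals \<open>\<beta>(v)\<close>
  for \<open>(u, \<beta>) \<in> E\<close> and \<open>v \<in> \<pi>(E\<^sup>\<bottom>)\<close>.\<close>

definition split_form :: "('m \<Rightarrow> 'e::real_inner gvector set) \<Rightarrow> 'm \<Rightarrow> 'e form" where
  "split_form E p = (\<lambda>vs. case vs of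
     [u, v] \<Rightarrow> blinfun_apply (snd (pr E p (u, 0))) (v - 2 *\<^sub>R fst (pr E p (v, 0))) | _ \<Rightarrow> 0)"

lemma split_form_eq:
  "split_form E p [u, v] = blinfun_apply (snd (pr E p (u, 0))) (v - 2 *\<^sub>R fst (pr E p (v, 0)))"
  by (simp add: split_form_def)

lemma split_form_zero: "length vs \<noteq> 2 \<Longrightarrow> split_form E p vs = 0"
  by (auto simp: split_form_def split: list.split)

section \<open>The 2-form of condition 4) and its adjoint action\<close>

context split_point
begin

lemma linear_pr_vector: "linear (\<lambda>u. P (u, 0))"
proof -
  have "linear (\<lambda>u. (u, 0) :: 'e gvector)" by (intro linearI) auto
  then show ?thesis using linear_compose[OF _ linear_pr] by (simp add: o_def)
qed

lemma split_form_alternating: "split_form E p [u, u] = 0"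
proof -
  have "0 = gbracket (P (u, 0)) ((u, 0) - P (u, 0))"
    by (simp add: gbracket_E_orth pr_mem pr_diff_mem)
  then show ?thesis
    by (simp add: split_form_eq gbracket_def blinfun.diff_right blinfun.diff_left
        blinfun.minus_left blinfun.scaleR_right)
qed

lemma split_form_forms_of_degree: "split_form E p \<in> forms_of_degree 2"
  unfolding forms_of_degree_def forms_def
proof (intro CollectI conjI allI impI)
  fix us vs :: "'e list"
  note simps = split_form_eq linear_add[OF linear_pr_vector] linear_scale[OF linear_pr_vector]
    blinfun.add_left blinfun.add_right blinfun.diff_right blinfun.scaleR_left blinfun.scaleR_right
    algebra_simps
  show "linear (\<lambda>v. split_form E p (us @ v # vs))"
  proof (cases "length us + length vs = 1")
    case True
    then consider w where "us = []" "vs = [w]" | w where "us = [w]" "vs = []"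
      by (cases us; cases vs) auto
    then show ?thesis by cases (auto intro!: linearI simp: simps)
  next
    case False
    then show ?thesis by (simp add: split_form_zero linear_zero)
  qed
next
  fix us vs ws :: "'e list" and v
  show "split_form E p (us @ v # vs @ v # ws) = 0"
  proof (cases "us = [] \<and> vs = [] \<and> ws = []")
    case False
    then show ?thesis by (intro split_form_zero) auto
  qed (simp add: split_form_alternating)
qed (simp add: split_form_zero)

sublocale two_form \<B> "split_form E p"
  by unfold_locales (rule split_form_forms_of_degree)

text \<open>The vector part of P(v, 0) always lies in F and the remainder in G. Once the sum is
  direct, it is therefore the projection of TM onto F along G.\<close>

lemma fst_pr_vector:
  assumes preserves_cotangent
  shows "v \<in> fst ` E p \<Longrightarrow> fst (P (v, 0)) = v" and "v \<in> fst ` orth E p \<Longrightarrow> fst (P (v, 0)) = 0"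
proof -
  have F: "fst (P (v, 0)) \<in> fst ` E p" and G: "v - fst (P (v, 0)) \<in> fst ` orth E p"
    using pr_mem[of "(v, 0)"] pr_diff_mem[of "(v, 0)"] by (force simp: image_iff)+
  have eq: "x = 0" if "x \<in> fst ` E p" "x \<in> fst ` orth E p" for x
    using that assms preserves_cotangent_iff_inter by blast
  show "fst (P (v, 0)) = v" if "v \<in> fst ` E p"
    using eq[of "v - fst (P (v, 0))"] G subspace_diff[OF subspace_projections(1) that F] by simp
  show "fst (P (v, 0)) = 0" if "v \<in> fst ` orth E p"
    using eq[of "fst (P (v, 0))"] F subspace_diff[OF subspace_projections(2) that G] by simp
qed

lemma Ad_image_split_form:
  assumes pc: preserves_cotangent
  shows "Ad_image (split_form E p) (E p) = fst ` E p \<times> annihilator (fst ` orth E p)"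
    and "Ad_image (split_form E p) (orth E p) = fst ` orth E p \<times> annihilator (fst ` E p)"
proof -
  note slot = blinfun_apply_slot[OF form] split_form_eq
  note proj = fst_pr_vector[OF pc]
  \<comment> \<open>Both (Y, \<beta>) and P(Y, 0) lie in E over Y, so they differ by a covector in
    E, that is, in Ann(G). On G the contraction of the form by Y is the covector part of P(Y,
    0).\<close>
  have E: "\<beta> - slot (split_form E p) Y \<in> annihilator (fst ` orth E p)" if y: "(Y, \<beta>) \<in> E p" for Y \<beta>
  proof -
    have "Y \<in> fst ` E p" using y by force
    then have "(Y, \<beta>) - P (Y, 0) = (0, \<beta> - snd (P (Y, 0)))" by (simp add: prod_eq_iff proj(1))
    then have "(0, \<beta> - snd (P (Y, 0))) \<in> E p"
      using subspace_diff[OF subspace_E y pr_mem[of "(Y, 0)"]] by simp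
    then have "\<beta> - snd (P (Y, 0)) \<in> annihilator (fst ` orth E p)" by (simp add: annihilator_orth_iff)
    then show ?thesis by (auto simp: annihilator_def slot blinfun.diff_left proj)
  qed
  have O: "\<beta> - slot (split_form E p) Y \<in> annihilator (fst ` E p)" if y: "(Y, \<beta>) \<in> orth E p" for Y \<beta>
  proof -
    have "Y \<in> fst ` orth E p" using y by force
    \<comment> \<open>In the complement the element over Y to compare with is (Y, 0) - P(Y, 0),
      whose covector part carries the opposite sign.\<close>
    then have "(Y, 0) - P (Y, 0) = (Y, - snd (P (Y, 0)))" by (simp add: prod_eq_iff proj(2))
    then have "(Y, - snd (P (Y, 0))) \<in> orth E p"
      using pr_diff_mem[of "(Y, 0)"] by simp
    from subspace_diff[OF subspace_orth y this]
    have "\<beta> + snd (P (Y, 0)) \<in> annihilator (fst ` E p)" by (simp add: annihilator_E_iff)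
    then have "blinfun_apply \<beta> v + blinfun_apply (snd (P (Y, 0))) v = 0" if "v \<in> fst ` E p" for v
      using that unfolding annihilator_def by (auto simp: blinfun.add_left)
    note sum = this
    show ?thesis
      unfolding annihilator_def
    proof (intro CollectI ballI)
      fix v assume v: "v \<in> fst ` E p"
      \<comment> \<open>Here the factor 2 acts: on F it replaces v by -v, which is the sign
        required.\<close>
      have "v - 2 *\<^sub>R fst (P (v, 0)) = - v" by (simp add: proj(1)[OF v] scaleR_2)
      then show "blinfun_apply (\<beta> - slot (split_form E p) Y) v = 0"
        using sum[OF v] by (simp add: slot blinfun.diff_left blinfun.minus_right)
    qed
  qed
  have ann: "subspace (annihilator S)" for S :: "'e set"
    by (auto simp: subspace_def annihilator_def blinfun.add_left blinfun.scaleR_left)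
  show "Ad_image (split_form E p) (E p) = fst ` E p \<times> annihilator (fst ` orth E p)"
    unfolding Ad_image_eq
  proof (intro subset_antisym subsetI)
    fix z assume "z \<in> fst ` E p \<times> annihilator (fst ` orth E p)"
    then obtain Y \<beta> where z: "(Y, \<beta>) \<in> E p" "fst z = Y" "snd z \<in> annihilator (fst ` orth E p)"
      by (auto simp: mem_Times_iff)
    \<comment> \<open>An arbitrary lift (Y, \<beta>) of Y to E is corrected by a covector in Ann(G),
      which does not leave E.\<close>
    let ?\<gamma> = "snd z - (\<beta> - slot (split_form E p) Y)"
    have "?\<gamma> \<in> annihilator (fst ` orth E p)" by (rule subspace_diff[OF ann z(3) E[OF z(1)]])
    then have "(Y, \<beta>) + (0, ?\<gamma>) \<in> E p"
      by (intro subspace_add[OF subspace_E z(1)]) (simp add: annihilator_orth_iff)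
    then show "z \<in> (\<lambda>y. (fst y, snd y - slot (split_form E p) (fst y))) ` E p"
      using z(2) by (intro rev_image_eqI) (auto simp: prod_eq_iff)
  qed (auto simp: E)
  show "Ad_image (split_form E p) (orth E p) = fst ` orth E p \<times> annihilator (fst ` E p)"
    unfolding Ad_image_eq
  proof (intro subset_antisym subsetI)
    fix z assume "z \<in> fst ` orth E p \<times> annihilator (fst ` E p)"
    then obtain Y \<beta> where z: "(Y, \<beta>) \<in> orth E p" "fst z = Y" "snd z \<in> annihilator (fst ` E p)"
      by (auto simp: mem_Times_iff)
    let ?\<gamma> = "snd z - (\<beta> - slot (split_form E p) Y)"
    have "?\<gamma> \<in> annihilator (fst ` E p)" by (rule subspace_diff[OF ann z(3) O[OF z(1)]])
    then have "(Y, \<beta>) + (0, ?\<gamma>) \<in> orth E p"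
      by (intro subspace_add[OF subspace_orth z(1)]) (simp add: annihilator_E_iff)
    then show "z \<in> (\<lambda>y. (fst y, snd y - slot (split_form E p) (fst y))) ` orth E p"
      using z(2) by (intro rev_image_eqI) (auto simp: prod_eq_iff)
  qed (auto simp: O)
qed

text \<open>For x in F and G the element (x, 0) lies in both images. The shear is injective, so its
  two preimages coincide and lie in E and in the complement, which forces x = 0.\<close>

lemma preserves_cotangent_if_Ad_image:
  assumes B: "B \<in> forms_of_degree 2"
    and E: "Ad_image B (E p) = fst ` E p \<times> annihilator (fst ` orth E p)"
    and O: "Ad_image B (orth E p) = fst ` orth E p \<times> annihilator (fst ` E p)"
  shows preserves_cotangent
proof -
  interpret B: two_form \<B> B by unfold_locales (rule B)
  have "x = 0" if x: "x \<in> fst ` E p" "x \<in> fst ` orth E p" for x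
  proof -
    have 0: "0 \<in> annihilator S" for S :: "'e set" by (simp add: annihilator_def)
    have "(x, 0) \<in> Ad_image B (E p)" "(x, 0) \<in> Ad_image B (orth E p)"
      unfolding E O using x 0 by auto
    then obtain y y' where "y \<in> E p" "x = fst y" "snd y = slot B x"
      "y' \<in> orth E p" "x = fst y'" "snd y' = slot B x"
      unfolding B.Ad_image_eq by auto
    then have "y \<in> E p" "y \<in> orth E p" "x = fst y" by (simp_all add: prod_eq_iff[symmetric]) (metis prod_eqI)
    then show "x = 0" using E_inter_orth by fastforce
  qed
  moreover have "0 \<in> fst ` E p \<inter> fst ` orth E p"
    using subspace_0[OF subspace_projections(1)] subspace_0[OF subspace_projections(2)] by simp
  ultimately show ?thesis unfolding preserves_cotangent_iff_inter by blast
qed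

end

section \<open>Smooth functions and vector fields on a manifold\<close>

locale smooth_mfd = orthonormal_basis \<B> for \<B> :: "'e::real_inner set" +
  fixes A :: "('m::{t2_space, second_countable_topology}, 'e) chart set"
  assumes smooth_manifold: "smooth_manifold A"
begin

lemma open_domain: "c \<in> A \<Longrightarrow> open (fst c)"
  and open_codomain: "c \<in> A \<Longrightarrow> open (snd c ` fst c)"
  and chart_homeomorphism: "c \<in> A \<Longrightarrow> homeomorphism (fst c) (snd c ` fst c) (snd c) (chart_inv c)"
  and smooth_transition: "c \<in> A \<Longrightarrow> d \<in> A \<Longrightarrow>
    smooth_on (snd c ` (fst c \<inter> fst d)) (snd d \<circ> chart_inv c)"
  and charts_cover: "\<exists>c\<in>A. p \<in> fst c"
  using smooth_manifold unfolding smooth_manifold_def by auto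

lemma chart_inv_chart: "c \<in> A \<Longrightarrow> q \<in> fst c \<Longrightarrow> chart_inv c (snd c q) = q"
  using chart_homeomorphism homeomorphism_apply1 by blast

lemma chart_chart_inv: "c \<in> A \<Longrightarrow> y \<in> snd c ` fst c \<Longrightarrow> snd c (chart_inv c y) = y"
  using chart_homeomorphism homeomorphism_apply2 by blast

lemma open_image:
  assumes "c \<in> A" "open W" shows "open (snd c ` (fst c \<inter> W))"
proof -
  have "snd c ` (fst c \<inter> W) = snd c ` fst c \<inter> chart_inv c -` W"
    using chart_inv_chart[OF assms(1)] by (force simp: image_iff)
  moreover have "continuous_on (snd c ` fst c) (chart_inv c)"
    using chart_homeomorphism[OF assms(1)] by (simp add: homeomorphism_def)
  ultimately show ?thesis
    using continuous_open_preimage open_codomain[OF assms(1)] assms(2) by metis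
qed

lemma chart_at: "chart_at A p \<in> A" "p \<in> fst (chart_at A p)"
  using someI_ex[OF charts_cover[of p, unfolded Bex_def]] by (simp_all add: chart_at_def)

text \<open>The Jacobian of a change of charts. \<open>to_coords\<close> and
  \<open>from_coords\<close> are the instances with the selected chart at one end, so one cocycle
  law covers them.\<close>

definition transition :: "('m, 'e) chart \<Rightarrow> ('m, 'e) chart \<Rightarrow> 'm \<Rightarrow> 'e \<Rightarrow> 'e" where
  "transition c d p = frechet_derivative (snd d \<circ> chart_inv c) (at (snd c p))"

lemma to_coords_eq: "to_coords A c p = transition (chart_at A p) c p"
  and from_coords_eq: "from_coords A c p = transition c (chart_at A p) p"
  by (simp_all add: to_coords_def from_coords_def transition_def)

lemma transition_has_derivative:
  assumes "c \<in> A" "d \<in> A" "p \<in> fst c" "p \<in> fst d"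
  shows "((snd d \<circ> chart_inv c) has_derivative transition c d p) (at (snd c p))"
  unfolding transition_def
  by (rule smooth_on_has_derivative[OF smooth_transition[OF assms(1,2)]]) (use assms in auto)

lemma linear_transition:
  "c \<in> A \<Longrightarrow> d \<in> A \<Longrightarrow> p \<in> fst c \<Longrightarrow> p \<in> fst d \<Longrightarrow> linear (transition c d p)"
  using has_derivative_linear[OF transition_has_derivative] .

text \<open>Chain rule; on the overlap, which is open, the composite of two coordinate changes
  agrees with the direct one.\<close>

lemma transition_compose:
  assumes "c \<in> A" "d \<in> A" "e \<in> A" "p \<in> fst c" "p \<in> fst d" "p \<in> fst e"
  shows "transition d e p (transition c d p v) = transition c e p v"
proof -
  let ?S = "snd c ` (fst c \<inter> fst d)"
  have "((snd e \<circ> chart_inv d) has_derivative transition d e p) (at ((snd d \<circ> chart_inv c) (snd c p)))"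
    using transition_has_derivative[OF assms(2,3,5,6)] assms by (simp add: chart_inv_chart)
  from diff_chain_at[OF transition_has_derivative[OF assms(1,2,4,5)] this]
  have "((snd e \<circ> chart_inv d) \<circ> (snd d \<circ> chart_inv c) has_derivative
      transition d e p \<circ> transition c d p) (at (snd c p))" .
  moreover have "((snd e \<circ> chart_inv d) \<circ> (snd d \<circ> chart_inv c)) y = (snd e \<circ> chart_inv c) y" if "y \<in> ?S" for y
    using that assms by (auto simp: chart_inv_chart)
  moreover have "open ?S" "snd c p \<in> ?S" using open_image[OF assms(1) open_domain[OF assms(2)]] assms by auto
  ultimately have "((snd e \<circ> chart_inv c) has_derivative transition d e p \<circ> transition c d p) (at (snd c p))"
    using has_derivative_transform_within_open by blast
  from has_derivative_unique[OF this transition_has_derivative[OF assms(1,3,4,6)]]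
  show ?thesis by (metis comp_apply)
qed

lemma transition_self:
  assumes "c \<in> A" "p \<in> fst c"
  shows "transition c c p v = v"
proof -
  have "((\<lambda>y. y) has_derivative (\<lambda>v. v)) (at (snd c p))" by (rule has_derivative_ident)
  moreover have "y = (snd c \<circ> chart_inv c) y" if "y \<in> snd c ` fst c" for y
    using chart_chart_inv[OF assms(1) that] by simp
  ultimately have "((snd c \<circ> chart_inv c) has_derivative (\<lambda>v. v)) (at (snd c p))"
    using has_derivative_transform_within_open[OF _ open_codomain[OF assms(1)]] assms by blast
  from has_derivative_unique[OF this transition_has_derivative[OF assms(1,1,2,2)]]
  show ?thesis by metis
qed

lemma linear_coords:
  assumes "c \<in> A" "p \<in> fst c"
  shows "linear (to_coords A c p)" "linear (from_coords A c p)"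
  unfolding to_coords_eq from_coords_eq using assms by (auto intro: linear_transition chart_at)

lemma to_from_coords:
  assumes "c \<in> A" "d \<in> A" "p \<in> fst c" "p \<in> fst d"
  shows "to_coords A d p (from_coords A c p v) = transition c d p v"
  unfolding to_coords_eq from_coords_eq using assms by (intro transition_compose chart_at)

lemma from_to_coords:
  assumes "c \<in> A" "p \<in> fst c"
  shows "from_coords A c p (to_coords A c p v) = v"
  unfolding to_coords_eq from_coords_eq
  using assms transition_self[OF chart_at] transition_compose[OF chart_at(1) assms(1) chart_at(1) chart_at(2) assms(2) chart_at(2)]
  by simp

section \<open>Smooth functions, vector fields and covector fields on open subsets\<close>

definition smooth_fun :: "'m set \<Rightarrow> ('m \<Rightarrow> real) \<Rightarrow> bool" where
  "smooth_fun W f \<longleftrightarrow> (\<forall>c\<in>A. smooth_on (snd c ` (fst c \<inter> W)) (\<lambda>y. f (chart_inv c y)))"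

lemma smooth_fun_const: "smooth_fun W (\<lambda>p. a)"
  by (simp add: smooth_fun_def)

lemma smooth_fun_add:
  "open W \<Longrightarrow> smooth_fun W f \<Longrightarrow> smooth_fun W g \<Longrightarrow> smooth_fun W (\<lambda>p. f p + g p)"
  by (simp add: smooth_fun_def open_image smooth_on_add)

lemma smooth_fun_mult:
  "open W \<Longrightarrow> smooth_fun W f \<Longrightarrow> smooth_fun W g \<Longrightarrow> smooth_fun W (\<lambda>p. f p * g p)"
  by (simp add: smooth_fun_def open_image smooth_on_mult)

lemma smooth_fun_sum:
  "open W \<Longrightarrow> (\<And>i. i \<in> I \<Longrightarrow> smooth_fun W (f i)) \<Longrightarrow> smooth_fun W (\<lambda>p. \<Sum>i\<in>I. f i p)"
  by (simp add: smooth_fun_def open_image smooth_on_sum)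

lemma smooth_fun_minv:
  assumes "open W" "\<And>i j. i < k \<Longrightarrow> j < k \<Longrightarrow> smooth_fun W (\<lambda>p. G p i j)"
    and "\<And>p. p \<in> W \<Longrightarrow> mdet k (G p) \<noteq> 0" "i < k" "j < k"
  shows "smooth_fun W (\<lambda>p. minv k (G p) i j)"
  unfolding smooth_fun_def
proof
  fix c assume c: "c \<in> A"
  have "chart_inv c y \<in> W" if "y \<in> snd c ` (fst c \<inter> W)" for y
    using that chart_inv_chart[OF c] by auto
  then show "smooth_on (snd c ` (fst c \<inter> W)) (\<lambda>y. minv k (G (chart_inv c y)) i j)"
    using assms c by (intro smooth_on_minv open_image) (auto simp: smooth_fun_def)
qed

lemma smooth_fun_local:
  assumes "open W" "\<And>p. p \<in> W \<Longrightarrow> \<exists>U. open U \<and> p \<in> U \<and> smooth_fun U f"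
  shows "smooth_fun W f"
  unfolding smooth_fun_def
proof (intro ballI smooth_on_local)
  fix c y assume c: "c \<in> A" and "y \<in> snd c ` (fst c \<inter> W)"
  then obtain q where q: "y = snd c q" "q \<in> fst c" "q \<in> W" by blast
  obtain U where U: "open U" "q \<in> U" "smooth_fun U f" using assms(2)[OF q(3)] by blast
  show "\<exists>V. open V \<and> y \<in> V \<and> smooth_on V (\<lambda>y. f (chart_inv c y))"
    using U q c by (intro exI[of _ "snd c ` (fst c \<inter> U)"]) (auto simp: open_image smooth_fun_def)
qed

lemma smooth_vector_field_on_subset:
  "smooth_vector_field_on A W X \<Longrightarrow> V \<subseteq> W \<Longrightarrow> smooth_vector_field_on A V X"
  unfolding smooth_vector_field_on_def by (meson smooth_on_subset image_mono Int_mono subset_refl)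

lemma smooth_covector_field_on_subset:
  "smooth_covector_field_on A W \<alpha> \<Longrightarrow> V \<subseteq> W \<Longrightarrow> smooth_covector_field_on A V \<alpha>"
  unfolding smooth_covector_field_on_def by (meson smooth_on_subset image_mono Int_mono subset_refl)

lemma smooth_vector_field_on_cong:
  assumes W: "open W" and eq: "\<And>p. p \<in> W \<Longrightarrow> X p = Y p" and X: "smooth_vector_field_on A W X"
  shows "smooth_vector_field_on A W Y"
  unfolding smooth_vector_field_on_def
proof
  fix c assume c: "c \<in> A"
  have "chart_inv c y \<in> W" if "y \<in> snd c ` (fst c \<inter> W)" for y
    using that chart_inv_chart[OF c] by auto
  moreover have "smooth_on (snd c ` (fst c \<inter> W)) (\<lambda>y. to_coords A c (chart_inv c y) (X (chart_inv c y)))"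
    using X c by (simp add: smooth_vector_field_on_def)
  ultimately show "smooth_on (snd c ` (fst c \<inter> W)) (\<lambda>y. to_coords A c (chart_inv c y) (Y (chart_inv c y)))"
    using eq by (elim smooth_on_cong[OF open_image[OF c W], rotated]) simp
qed

lemma smooth_covector_field_on_cong:
  assumes W: "open W" and eq: "\<And>p. p \<in> W \<Longrightarrow> \<alpha> p = \<beta> p" and \<alpha>: "smooth_covector_field_on A W \<alpha>"
  shows "smooth_covector_field_on A W \<beta>"
  unfolding smooth_covector_field_on_def
proof (intro ballI allI)
  fix c w assume c: "c \<in> A"
  have "chart_inv c y \<in> W" if "y \<in> snd c ` (fst c \<inter> W)" for y
    using that chart_inv_chart[OF c] by auto
  moreover have "smooth_on (snd c ` (fst c \<inter> W))
      (\<lambda>y. blinfun_apply (\<alpha> (chart_inv c y)) (from_coords A c (chart_inv c y) w))"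
    using \<alpha> c by (simp add: smooth_covector_field_on_def)
  ultimately show "smooth_on (snd c ` (fst c \<inter> W))
      (\<lambda>y. blinfun_apply (\<beta> (chart_inv c y)) (from_coords A c (chart_inv c y) w))"
    using eq by (elim smooth_on_cong[OF open_image[OF c W], rotated]) simp
qed

lemma smooth_vector_field_on_linear_combination:
  assumes W: "open W" and "\<And>i. i \<in> I \<Longrightarrow> smooth_fun W (f i)"
    and "\<And>i. i \<in> I \<Longrightarrow> smooth_vector_field_on A W (X i)"
  shows "smooth_vector_field_on A W (\<lambda>p. \<Sum>i\<in>I. f i p *\<^sub>R X i p)"
  unfolding smooth_vector_field_on_def
proof
  fix c assume c: "c \<in> A"
  let ?q = "chart_inv c"
  show "smooth_on (snd c ` (fst c \<inter> W)) (\<lambda>y. to_coords A c (?q y) (\<Sum>i\<in>I. f i (?q y) *\<^sub>R X i (?q y)))"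
  proof (rule smooth_on_cong)
    show "smooth_on (snd c ` (fst c \<inter> W)) (\<lambda>y. \<Sum>i\<in>I. f i (?q y) *\<^sub>R to_coords A c (?q y) (X i (?q y)))"
      using assms c by (intro smooth_on_sum smooth_on_scaleR open_image)
        (auto simp: smooth_fun_def smooth_vector_field_on_def)
  qed (auto simp: c W open_image chart_inv_chart linear_sum[OF linear_coords(1)] linear_scale[OF linear_coords(1)])
qed

lemma smooth_covector_field_on_linear_combination:
  assumes W: "open W" and "\<And>i. i \<in> I \<Longrightarrow> smooth_fun W (f i)"
    and "\<And>i. i \<in> I \<Longrightarrow> smooth_covector_field_on A W (\<alpha> i)"
  shows "smooth_covector_field_on A W (\<lambda>p. \<Sum>i\<in>I. f i p *\<^sub>R \<alpha> i p)"
  unfolding smooth_covector_field_on_def blinfun.sum_left blinfun.scaleR_left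
  using assms
  by (intro ballI allI smooth_on_sum smooth_on_scaleR open_image)
    (auto simp: smooth_fun_def smooth_covector_field_on_def)

text \<open>In a chart the value is a sum of products of components, with respect to the basis and
  its coordinate fields, and these components are smooth.\<close>

lemma smooth_fun_apply:
  assumes W: "open W" and X: "smooth_vector_field_on A W X" and \<alpha>: "smooth_covector_field_on A W \<alpha>"
  shows "smooth_fun W (\<lambda>p. blinfun_apply (\<alpha> p) (X p))"
  unfolding smooth_fun_def
proof
  fix c assume c: "c \<in> A"
  let ?q = "chart_inv c"
  show "smooth_on (snd c ` (fst c \<inter> W)) (\<lambda>y. blinfun_apply (\<alpha> (?q y)) (X (?q y)))"
  proof (rule smooth_on_cong)
    have "smooth_on (snd c ` (fst c \<inter> W)) (\<lambda>y. inner (to_coords A c (?q y) (X (?q y))) b)" for b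
      using X c by (intro smooth_on_linear[OF bounded_linear_inner_left] open_image W)
        (auto simp: smooth_vector_field_on_def)
    then show "smooth_on (snd c ` (fst c \<inter> W))
      (\<lambda>y. \<Sum>b\<in>\<B>. inner (to_coords A c (?q y) (X (?q y))) b * blinfun_apply (\<alpha> (?q y)) (from_coords A c (?q y) b))"
      using \<alpha> c by (intro smooth_on_sum smooth_on_mult open_image W) (auto simp: smooth_covector_field_on_def)
  next
    fix y assume "y \<in> snd c ` (fst c \<inter> W)"
    then have q: "?q y \<in> fst c" using c by (auto simp: chart_inv_chart)
    have "linear (\<lambda>v. blinfun_apply (\<alpha> (?q y)) (from_coords A c (?q y) v))"
      using linear_compose[OF linear_coords(2)[OF c q]
          bounded_linear.linear[OF blinfun.bounded_linear_right]] by (simp add: o_def)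
    from linear_expand[OF this, of "to_coords A c (?q y) (X (?q y))"]
    show "(\<Sum>b\<in>\<B>. inner (to_coords A c (?q y) (X (?q y))) b * blinfun_apply (\<alpha> (?q y)) (from_coords A c (?q y) b))
      = blinfun_apply (\<alpha> (?q y)) (X (?q y))"
      by (simp add: from_to_coords[OF c q])
  qed (rule open_image[OF c W])
qed

text \<open>In another chart d the components are a directional derivative of the smooth coordinate
  change, taken at a point that depends smoothly on y. These fields are the local inputs to which
  the projection is later applied.\<close>

lemma smooth_coordinate_field:
  assumes "c \<in> A"
  shows "smooth_vector_field_on A (fst c) (\<lambda>p. from_coords A c p w)"
  unfolding smooth_vector_field_on_def
proof
  fix d assume d: "d \<in> A"
  let ?S = "snd d ` (fst d \<inter> fst c)" and ?T = "snd c ` (fst c \<inter> fst d)"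
  have S: "open ?S" and T: "open ?T" using assms d by (auto intro: open_image open_domain)
  show "smooth_on ?S (\<lambda>y. to_coords A d (chart_inv d y) (from_coords A c (chart_inv d y) w))"
  proof (rule smooth_on_cong[OF S])
    show "smooth_on ?S (\<lambda>y. frechet_derivative (snd d \<circ> chart_inv c) (at ((snd c \<circ> chart_inv d) y)) w)"
    proof (rule smooth_on_compose[OF S T _ smooth_on_frechet_derivative])
      show "(snd c \<circ> chart_inv d) ` ?S \<subseteq> ?T" using d by (auto simp: chart_inv_chart)
    qed (intro smooth_transition assms d)+
  qed (use assms d in \<open>auto simp: chart_inv_chart to_from_coords transition_def\<close>)
qed

lemma differential_surjective: "\<exists>f. smooth_function A f \<and> differential A f p = \<alpha>"
proof -
  define c where "c = chart_at A p"
  have c: "c \<in> A" "p \<in> fst c" using chart_at by (simp_all add: c_def)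
  obtain R where R: "R > 0" "ball (snd c p) R \<subseteq> snd c ` fst c"
    using open_codomain[OF c(1)] c(2) open_contains_ball by (metis image_eqI)
  \<comment> \<open>Half the radius, so that the closed ball containing the support still lies in
    the image of the chart.\<close>
  obtain h :: "'e \<Rightarrow> real" where h: "smooth_on UNIV h" "h (snd c p) \<noteq> 0"
      "\<And>y. h y \<noteq> 0 \<Longrightarrow> dist (snd c p) y < R / 2"
    using bump_function[of "R / 2" "snd c p"] R(1) by auto
  \<comment> \<open>The linear factor vanishes at the base point, so the derivative of the bump does
    not contribute; the division normalises the bump to 1 there.\<close>
  define g where "g y = h y / h (snd c p) * blinfun_apply \<alpha> (y - snd c p)" for y
  define f where "f q = (if q \<in> fst c then g (snd c q) else 0)" for q
  let ?B = "cball (snd c p) (R / 2)"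
  have g_smooth: "smooth_on UNIV g"
  proof -
    have "smooth_on UNIV (\<lambda>y. blinfun_apply \<alpha> (y - snd c p))"
      by (rule smooth_on_linear[OF blinfun.bounded_linear_right]) (auto intro: smooth_on_diff smooth_on_id)
    then show ?thesis unfolding g_def divide_inverse
      by (intro smooth_on_mult h smooth_on_const open_UNIV)
  qed
  have g_zero: "g y = 0" if "y \<notin> ?B" for y
    using h(3)[of y] that by (auto simp: g_def)
  have B: "?B \<subseteq> snd c ` fst c" using R by (force simp: subset_iff)
  have "compact (chart_inv c ` ?B)"
    using chart_homeomorphism[OF c(1)] B
    by (intro compact_continuous_image compact_cball_basis) (auto simp: homeomorphism_def intro: continuous_on_subset)
  \<comment> \<open>The Hausdorff property enters here: a compact set is closed in the whole
    manifold, so the extension by 0 vanishes on an open set around every point outside the chart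
    domain.\<close>
  then have closed: "closed (chart_inv c ` ?B)" by (rule compact_imp_closed)
  have "smooth_function A f"
    unfolding smooth_function_def
  proof (intro ballI smooth_on_local)
    fix d y assume d: "d \<in> A" and "y \<in> snd d ` fst d"
    then obtain q where q: "q \<in> fst d" "y = snd d q" by blast
    show "\<exists>U. open U \<and> y \<in> U \<and> smooth_on U (f \<circ> chart_inv d)"
    proof (cases "q \<in> fst c")
      case True
      let ?U = "snd d ` (fst d \<inter> fst c)"
      have U: "open ?U" by (intro open_image open_domain c d)
      have "smooth_on ?U (f \<circ> chart_inv d)"
      proof (rule smooth_on_cong[OF U])
        show "smooth_on ?U (\<lambda>y. g ((snd c \<circ> chart_inv d) y))"
          by (rule smooth_on_compose[OF U open_UNIV subset_UNIV g_smooth smooth_transition[OF d c(1)]])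
      qed (use d in \<open>auto simp: f_def chart_inv_chart\<close>)
      then show ?thesis using U True q by (intro exI[of _ ?U]) auto
    next
      case False
      let ?U = "snd d ` (fst d \<inter> - (chart_inv c ` ?B))"
      have U: "open ?U" using closed by (intro open_image d) auto
      have "smooth_on ?U (f \<circ> chart_inv d)"
      proof (rule smooth_on_cong[OF U])
        show "smooth_on ?U (\<lambda>y. 0)" by simp
      next
        fix y assume "y \<in> ?U"
        then obtain q' where q': "q' \<in> fst d" "q' \<notin> chart_inv c ` ?B" "y = snd d q'" by blast
        have "f q' = 0"
        proof (cases "q' \<in> fst c")
          case True
          then have "snd c q' \<notin> ?B" using q'(2) chart_inv_chart[OF c(1) True] by (metis image_eqI)
          then show ?thesis using True g_zero by (simp add: f_def)
        qed (simp add: f_def)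
        then show "0 = (f \<circ> chart_inv d) y" using q' d by (simp add: chart_inv_chart)
      qed
      moreover have "q \<notin> chart_inv c ` ?B"
        using False B c(1) by (auto simp: chart_inv_chart)
      ultimately show ?thesis using U q by (intro exI[of _ ?U]) auto
    qed
  qed
  moreover have "differential A f p = \<alpha>"
  proof -
    obtain h' where h': "(h has_derivative h') (at (snd c p))"
      using smooth_on_has_derivative[OF h(1)] by blast
    have "((\<lambda>y. h y / h (snd c p)) has_derivative (\<lambda>v. h' v / h (snd c p))) (at (snd c p))"
      using has_derivative_mult_left[OF h', of "inverse (h (snd c p))"] by (simp add: divide_inverse)
    moreover have "((\<lambda>y. blinfun_apply \<alpha> (y - snd c p)) has_derivative blinfun_apply \<alpha>) (at (snd c p))"
      by (auto intro!: derivative_eq_intros)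
    ultimately have "(g has_derivative blinfun_apply \<alpha>) (at (snd c p))"
      unfolding g_def[abs_def] using has_derivative_mult[of "\<lambda>y. h y / h (snd c p)" _ "snd c p" UNIV
          "\<lambda>y. blinfun_apply \<alpha> (y - snd c p)" "blinfun_apply \<alpha>"] h(2) by (simp add: blinfun.zero_right)
    moreover have "g y = (f \<circ> chart_inv c) y" if "y \<in> snd c ` fst c" for y
      using that c(1) by (auto simp: f_def chart_inv_chart)
    ultimately have "((f \<circ> chart_inv c) has_derivative blinfun_apply \<alpha>) (at (snd c p))"
      using has_derivative_transform_within_open[OF _ open_codomain[OF c(1)]] c(2) by blast
    then have "frechet_derivative (f \<circ> chart_inv c) (at (snd c p)) = blinfun_apply \<alpha>"
      using frechet_derivative_at by metis
    then show ?thesis by (simp add: differential_def c_def[symmetric] blinfun_apply_inverse)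
  qed
  ultimately show ?thesis by blast
qed

end

section \<open>Smoothness of the orthogonal projection\<close>

locale split_mfd = smooth_mfd \<B> A
  for \<B> :: "'e::real_inner set" and A :: "('m::{t2_space, second_countable_topology}, 'e) chart set" +
  fixes E :: "'m \<Rightarrow> 'e gvector set" and r :: nat
  assumes split: "split_structure A r E"
begin

lemma local_frame:
  obtains W s where "open W" "p \<in> W" "\<And>i. i < 2 * r \<Longrightarrow> smooth_gsection_on A W (s i)"
    and "\<And>q. q \<in> W \<Longrightarrow> split_point \<B> E q (2 * r) (\<lambda>i. s i q)"
proof -
  have "subbundle_of_rank (smooth_gsection_on A) (2 * r) E"
    using split by (simp add: split_structure_def)
  then obtain W s where W: "open W" "p \<in> W" "\<forall>i<2 * r. smooth_gsection_on A W (s i)"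
    "\<forall>q\<in>W. inj_on (\<lambda>i. s i q) {..<2 * r} \<and> independent ((\<lambda>i. s i q) ` {..<2 * r}) \<and>
       span ((\<lambda>i. s i q) ` {..<2 * r}) = E q"
    unfolding subbundle_of_rank_def by (elim allE[of _ p] exE conjE) (rule that)
  show ?thesis
  proof (rule that[OF W(1,2)])
    show "smooth_gsection_on A W (s i)" if "i < 2 * r" for i using W(3) that by blast
    show "split_point \<B> E q (2 * r) (\<lambda>i. s i q)" if "q \<in> W" for q
    proof (intro split_point.intro split_point_axioms.intro orthonormal_basis_axioms)
      show "nondegenerate_on pairing (E q)" using split by (simp add: split_structure_def)
      show "linindep (2 * r) (\<lambda>i. s i q)" "span ((\<lambda>i. s i q) ` {..<2 * r}) = E q"
        using W(4) that by (simp_all add: linindep_iff)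
    qed
  qed
qed

lemma split_point_exists: "\<exists>s. split_point \<B> E p (2 * r) s"
  by (rule local_frame[of p]) blast

text \<open>A frame chosen at each point, with no regularity in the point. It makes the pointwise
  results available at all points simultaneously; smoothness is argued with local frames
  instead.\<close>

definition frame_at :: "'m \<Rightarrow> nat \<Rightarrow> 'e gvector" where
  "frame_at p = (SOME s. split_point \<B> E p (2 * r) s)"

sublocale point: split_point \<B> E p "2 * r" "frame_at p" for p
  unfolding frame_at_def by (rule someI_ex[OF split_point_exists])

text \<open>Only vectors (u, 0) are treated, since the 2-form and the spanning fields of F and G use
  P only on these.\<close>

lemma smooth_projection:
  assumes V: "open V" and u: "smooth_vector_field_on A V u" and p: "p \<in> V"
  shows "\<exists>W. open W \<and> p \<in> W \<and> W \<subseteq> V \<and>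
    smooth_vector_field_on A W (\<lambda>q. fst (pr E q (u q, 0))) \<and>
    smooth_covector_field_on A W (\<lambda>q. snd (pr E q (u q, 0)))"
proof -
  obtain W' s where W': "open W'" "p \<in> W'" "\<And>i. i < 2 * r \<Longrightarrow> smooth_gsection_on A W' (s i)"
    and frame: "\<And>q. q \<in> W' \<Longrightarrow> split_point \<B> E q (2 * r) (\<lambda>i. s i q)"
    using local_frame[of p] by metis
  define W where "W = W' \<inter> V"
  have W: "open W" using W' V by (auto simp: W_def)
  define G where "G q i j = gbracket (s i q) (s j q)" for q i j
  define a where "a i q = (\<Sum>j<2 * r. minv (2 * r) (G q) i j * gbracket (s j q) (u q, 0))" for i q
  have s: "smooth_vector_field_on A W (\<lambda>q. fst (s i q))" "smooth_covector_field_on A W (\<lambda>q. snd (s i q))"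
    if "i < 2 * r" for i
    using W'(3)[OF that] smooth_vector_field_on_subset[of W' _ W] smooth_covector_field_on_subset[of W' _ W]
    by (auto simp: smooth_gsection_on_def W_def)
  have u': "smooth_vector_field_on A W u"
    using smooth_vector_field_on_subset[OF u] by (simp add: W_def)
  have G: "smooth_fun W (\<lambda>q. G q i j)" if "i < 2 * r" "j < 2 * r" for i j
    unfolding G_def gbracket_def by (intro smooth_fun_add smooth_fun_apply W s that)
  have inv: "smooth_fun W (\<lambda>q. minv (2 * r) (G q) i j)" if "i < 2 * r" "j < 2 * r" for i j
  proof (rule smooth_fun_minv[OF W G])
    fix q assume "q \<in> W"
    then interpret split_point \<B> E q "2 * r" "\<lambda>i. s i q" using frame by (simp add: W_def)
    show "mdet (2 * r) (G q) \<noteq> 0" using mdet_frame by (simp add: G_def[abs_def])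
  qed (use that in auto)
  have a: "smooth_fun W (a i)" if "i < 2 * r" for i
    unfolding a_def gbracket_vector using that
    by (intro smooth_fun_sum smooth_fun_mult smooth_fun_apply W inv u' s) auto
  have eq: "pr E q (u q, 0) = (\<Sum>i<2 * r. a i q *\<^sub>R s i q)" if "q \<in> W" for q
  proof -
    interpret split_point \<B> E q "2 * r" "\<lambda>i. s i q" using frame that by (simp add: W_def)
    show ?thesis by (simp add: pr_frame a_def G_def[abs_def])
  qed
  have "smooth_vector_field_on A W (\<lambda>q. fst (pr E q (u q, 0)))"
  proof (rule smooth_vector_field_on_cong[OF W])
    show "smooth_vector_field_on A W (\<lambda>q. \<Sum>i<2 * r. a i q *\<^sub>R fst (s i q))"
      by (intro smooth_vector_field_on_linear_combination W a s) auto
  qed (simp add: eq fst_sum)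
  moreover have "smooth_covector_field_on A W (\<lambda>q. snd (pr E q (u q, 0)))"
  proof (rule smooth_covector_field_on_cong[OF W])
    show "smooth_covector_field_on A W (\<lambda>q. \<Sum>i<2 * r. a i q *\<^sub>R snd (s i q))"
      by (intro smooth_covector_field_on_linear_combination W a s) auto
  qed (simp add: eq snd_sum)
  ultimately show ?thesis using W' p W by (intro exI[of _ W]) (auto simp: W_def)
qed

lemma smooth_split_form: "smooth_form_of_degree A 2 (split_form E)"
  unfolding smooth_form_of_degree_def
proof (intro conjI allI ballI)
  show "split_form E p \<in> forms_of_degree 2" for p
    by (rule point.split_form_forms_of_degree)
next
  fix c and ws :: "'e list" assume c: "c \<in> A"
  show "smooth_on (snd c ` fst c) (\<lambda>y. split_form E (chart_inv c y) (map (from_coords A c (chart_inv c y)) ws))"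
  proof (cases "length ws = 2")
    case False
    then show ?thesis by (simp add: split_form_zero)
  next
    case True
    then obtain w1 w2 where ws: "ws = [w1, w2]"
      by (auto simp: numeral_2_eq_2 length_Suc_conv)
    let ?u = "\<lambda>w q. from_coords A c q w"
    have "smooth_fun (fst c) (\<lambda>q. split_form E q [?u w1 q, ?u w2 q])"
    proof (rule smooth_fun_local[OF open_domain[OF c]])
      fix p assume p: "p \<in> fst c"
      note proj = smooth_projection[OF open_domain[OF c] smooth_coordinate_field[OF c] p]
      obtain W1 where W1: "open W1" "p \<in> W1" "W1 \<subseteq> fst c"
        "smooth_covector_field_on A W1 (\<lambda>q. snd (pr E q (?u w1 q, 0)))"
        using proj[of w1] by blast
      obtain W2 where W2: "open W2" "p \<in> W2" "smooth_vector_field_on A W2 (\<lambda>q. fst (pr E q (?u w2 q, 0)))"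
        using proj[of w2] by blast
      let ?W = "W1 \<inter> W2"
      have W: "open ?W" using W1 W2 by blast
      have \<xi>: "smooth_covector_field_on A ?W (\<lambda>q. snd (pr E q (?u w1 q, 0)))"
        by (rule smooth_covector_field_on_subset[OF W1(4)]) blast
      have X: "smooth_vector_field_on A ?W (\<lambda>q. fst (pr E q (?u w2 q, 0)))"
        by (rule smooth_vector_field_on_subset[OF W2(3)]) blast
      have v: "smooth_vector_field_on A ?W (?u w2)"
        by (rule smooth_vector_field_on_subset[OF smooth_coordinate_field[OF c]]) (use W1 in blast)
      have "smooth_fun ?W (\<lambda>q. blinfun_apply (snd (pr E q (?u w1 q, 0))) (?u w2 q)
          + (- 2) * blinfun_apply (snd (pr E q (?u w1 q, 0))) (fst (pr E q (?u w2 q, 0))))"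
        by (intro smooth_fun_add smooth_fun_mult smooth_fun_const smooth_fun_apply W \<xi> X v)
      then show "\<exists>U. open U \<and> p \<in> U \<and> smooth_fun U (\<lambda>q. split_form E q [?u w1 q, ?u w2 q])"
        using W W1 W2 by (intro exI[of _ ?W])
          (simp add: split_form_eq blinfun.diff_right blinfun.scaleR_right)
    qed
    from bspec[OF this[unfolded smooth_fun_def] c] show ?thesis by (simp add: ws)
  qed
qed

text \<open>Some members of the family form a basis at a point, and linear independence, being the
  non-vanishing of a Gram determinant, persists nearby; as the rank is constant they still span.\<close>

lemma tangent_subbundle_if_spanned:
  fixes F :: "'m \<Rightarrow> 'e set"
  assumes sub: "\<And>p. subspace (F p)" and dim: "\<And>p. dim (F p) = k"
    and spanned: "\<And>p. \<exists>W. open W \<and> p \<in> W \<and> (\<exists>X. (\<forall>b\<in>\<B>. smooth_vector_field_on A W (X b)) \<and>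
      (\<forall>q\<in>W. span ((\<lambda>b. X b q) ` \<B>) = F q))"
  shows "tangent_subbundle A F"
  unfolding tangent_subbundle_def subbundle_of_rank_def
proof (intro exI[of _ k] allI)
  fix p
  obtain W X where W: "open W" "p \<in> W" and X: "\<And>b. b \<in> \<B> \<Longrightarrow> smooth_vector_field_on A W (X b)"
    and span: "\<And>q. q \<in> W \<Longrightarrow> span ((\<lambda>b. X b q) ` \<B>) = F q"
    using spanned[of p] by metis
  obtain C where C: "C \<subseteq> (\<lambda>b. X b p) ` \<B>" "independent C" "(\<lambda>b. X b p) ` \<B> \<subseteq> span C"
    using maximal_independent_subset by blast
  have "F p = span C"
    unfolding span[OF W(2), symmetric] using C(1,3) by (metis span_mono span_span subset_antisym)
  then have "card C = k"
    using dim[of p] dim_span_eq_card_independent[OF C(2)] by simp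
  moreover have "finite C" using C(1) finite_basis finite_subset by blast
  ultimately obtain h where h: "bij_betw h {..<k} C"
    using ex_bij_betw_nat_finite by (metis atLeast0LessThan)
  \<comment> \<open>C consists of values at p. The choice records which member of the family each
    value came from, so that the same members can be followed to nearby points.\<close>
  define \<sigma> where "\<sigma> i = (SOME b. b \<in> \<B> \<and> X b p = h i)" for i
  have \<sigma>: "\<sigma> i \<in> \<B>" "X (\<sigma> i) p = h i" if "i < k" for i
  proof -
    have "h i \<in> C" using h that by (auto simp: bij_betw_def)
    then have "\<exists>b. b \<in> \<B> \<and> X b p = h i" using C(1) by force
    from someI_ex[OF this] show "\<sigma> i \<in> \<B>" "X (\<sigma> i) p = h i" by (simp_all add: \<sigma>_def)
  qed
  have "linindep k h" using h C(2) by (simp add: linindep_iff bij_betw_def)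
  then have indep_p: "linindep k (\<lambda>i. X (\<sigma> i) p)" by (simp add: linindep_def \<sigma>)
  obtain c where c: "c \<in> A" "p \<in> fst c" using charts_cover by blast
  \<comment> \<open>The stored vectors refer to selected charts that may jump with q, so the Gram
    determinant is formed from components in the single chart c; passing to components is injective
    and keeps independence.\<close>
  define t where "t q i = to_coords A c q (X (\<sigma> i) q)" for q i
  have inj: "inj (to_coords A c q)" "inj (from_coords A c q)" if "q \<in> fst c" for q
  proof -
    show "inj (to_coords A c q)" by (rule inj_on_inverseI[of _ "from_coords A c q"]) (rule from_to_coords[OF c(1) that])
    show "inj (from_coords A c q)"
      by (rule inj_on_inverseI[of _ "to_coords A c q"]) (simp add: to_from_coords transition_self c(1) that)
  qed
  let ?S = "snd c ` (fst c \<inter> W)"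
  let ?d = "\<lambda>q. mdet k (\<lambda>i j. inner (t q i) (t q j))"
  have S: "open ?S" by (rule open_image[OF c(1) W(1)])
  have t: "smooth_on ?S (\<lambda>y. inner (t (chart_inv c y) i) b)" if "i < k" for i b
    using X[OF \<sigma>(1)[OF that]] c(1)
    by (intro smooth_on_linear[OF bounded_linear_inner_left S])
      (simp add: smooth_vector_field_on_def t_def)
  have "smooth_on ?S (\<lambda>y. ?d (chart_inv c y))"
  proof (rule smooth_on_mdet[OF S])
    fix i j assume ij: "i < k" "j < k"
    have "smooth_on ?S (\<lambda>y. \<Sum>b\<in>\<B>. inner (t (chart_inv c y) i) b * inner (t (chart_inv c y) j) b)"
      by (intro smooth_on_sum smooth_on_mult S t ij)
    moreover have "(\<Sum>b\<in>\<B>. inner x b * inner y b) = inner x y" for x y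
      using arg_cong[OF expand[of y], of "inner x"] by (simp add: inner_sum_right mult.commute)
    ultimately show "smooth_on ?S (\<lambda>y. inner (t (chart_inv c y) i) (t (chart_inv c y) j))" by simp
  qed
  then have "continuous_on ?S (\<lambda>y. ?d (chart_inv c y))" by (rule smooth_on_imp_continuous_on)
  moreover have "continuous_on (fst c \<inter> W) (snd c)"
    using chart_homeomorphism[OF c(1)] by (auto simp: homeomorphism_def intro: continuous_on_subset)
  ultimately have "continuous_on (fst c \<inter> W) (\<lambda>q. ?d (chart_inv c (snd c q)))"
    by (rule continuous_on_compose2) (rule subset_refl)
  then have cont: "continuous_on (fst c \<inter> W) ?d"
    by (rule continuous_on_eq) (simp add: chart_inv_chart c(1))
  define U where "U = (fst c \<inter> W) \<inter> ?d -` (- {0})"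
  have U: "open U" unfolding U_def
    by (intro continuous_open_preimage cont open_Int open_domain c W) auto
  have "linindep k (t p)"
    unfolding t_def by (rule linindep_linear_image[OF linear_coords(1)[OF c] inj(1)[OF c(2)] indep_p])
  then have "p \<in> U" using c W by (simp add: U_def linindep_iff_gram)
  have indep: "linindep k (\<lambda>i. X (\<sigma> i) q)" and UW: "q \<in> W" if "q \<in> U" for q
  proof -
    have q: "q \<in> fst c" "q \<in> W" "linindep k (t q)" using that by (auto simp: U_def linindep_iff_gram)
    show "q \<in> W" by fact
    have "linindep k (\<lambda>i. from_coords A c q (t q i))"
      by (rule linindep_linear_image[OF linear_coords(2)[OF c(1) q(1)] inj(2)[OF q(1)] q(3)])
    then show "linindep k (\<lambda>i. X (\<sigma> i) q)" by (simp add: t_def from_to_coords[OF c(1) q(1)])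
  qed
  have "span ((\<lambda>i. X (\<sigma> i) q) ` {..<k}) = F q" if q: "q \<in> U" for q
  proof (rule subspace_eqI_dim[OF finite_basis span_basis subspace_span sub])
    have "(\<lambda>i. X (\<sigma> i) q) ` {..<k} \<subseteq> (\<lambda>b. X b q) ` \<B>" using \<sigma> by auto
    then show "span ((\<lambda>i. X (\<sigma> i) q) ` {..<k}) \<subseteq> F q"
      unfolding span[OF UW[OF q], symmetric] by (rule span_mono)
    show "dim (F q) \<le> dim (span ((\<lambda>i. X (\<sigma> i) q) ` {..<k}))"
      using indep[OF q] dim_span_eq_card_independent[of "(\<lambda>i. X (\<sigma> i) q) ` {..<k}"]
      by (simp add: dim linindep_iff card_image)
  qed
  moreover have "smooth_vector_field_on A U (X (\<sigma> i))" if "i < k" for i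
    by (rule smooth_vector_field_on_subset[OF X[OF \<sigma>(1)[OF that]]]) (auto simp: U_def)
  ultimately show "\<exists>W s. open W \<and> p \<in> W \<and> (\<forall>i<k. smooth_vector_field_on A W (s i)) \<and>
      (\<forall>q\<in>W. inj_on (\<lambda>i. s i q) {..<k} \<and> independent ((\<lambda>i. s i q) ` {..<k}) \<and>
        span ((\<lambda>i. s i q) ` {..<k}) = F q)"
    using U \<open>p \<in> U\<close> indep[unfolded linindep_iff]
    by (intro exI[of _ U] exI[of _ "\<lambda>i. X (\<sigma> i)"] conjI ballI allI impI) simp_all
qed

section \<open>The equivalences\<close>

definition preserving :: bool where
  "preserving \<longleftrightarrow> (\<forall>p \<alpha>. fst (pr E p (0, \<alpha>)) = 0)"

lemma preserving_iff: "preserving \<longleftrightarrow> (\<forall>p. point.preserves_cotangent p)"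
  by (simp add: preserving_def point.preserves_cotangent_def)

lemma gap_iff_preserving: "generalized_almost_product_structure A E \<longleftrightarrow> preserving"
proof -
  \<comment> \<open>The definition of a generalized almost product structure quantifies over the
    rank; the dimension of a single fibre identifies it with r.\<close>
  have "r' = r" if "split_structure A r' E" for r'
  proof -
    obtain p :: 'm where True by blast
    have "dim (E p) = 2 * l" if "split_structure A l E" for l
    proof -
      interpret l: split_mfd \<B> A E l by unfold_locales (rule that)
      obtain s where "split_point \<B> E p (2 * l) s" using l.split_point_exists by blast
      then interpret split_point \<B> E p "2 * l" s .
      show ?thesis
        using linindep span_frame by (metis card_image card_lessThan dim_span_eq_card_independent linindep_iff)
    qed
    from this[OF split] this[OF that] show ?thesis by simp
  qed
  then have "generalized_almost_product_structure A E \<longleftrightarrow> (\<forall>p. dim (fst ` E p) = r)"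
    unfolding generalized_almost_product_structure_def using split by blast
  also have "\<dots> \<longleftrightarrow> preserving"
    by (simp add: preserving_iff point.preserves_cotangent_iff_dim[OF refl])
  finally show ?thesis .
qed

lemma preserving_iff_decomposition:
  "preserving \<longleftrightarrow>
    (\<forall>p. direct_sum_decomposition cotangent (cotangent \<inter> E p) (cotangent \<inter> orth E p))"
  by (simp only: preserving_iff point.preserves_cotangent_iff_decomposition)

lemma almost_product_if_preserving:
  assumes preserving
  shows "almost_product_structure A (\<lambda>p. fst ` E p) (\<lambda>p. fst ` orth E p)"
proof -
  have decomp: "direct_sum_decomposition UNIV (fst ` E p) (fst ` orth E p)"
    "dim (fst ` E p) = r" "dim (fst ` orth E p) = card \<B> - r"
    "\<And>v. v \<in> fst ` E p \<Longrightarrow> fst (pr E p (v, 0)) = v"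
    "\<And>v. v \<in> fst ` orth E p \<Longrightarrow> fst (pr E p (v, 0)) = 0"
    "\<And>v. fst (pr E p (v, 0)) \<in> fst ` E p" "\<And>v. v - fst (pr E p (v, 0)) \<in> fst ` orth E p"
    "linear (\<lambda>v. fst (pr E p (v, 0)))" for p
  proof -
    have pc: "point.preserves_cotangent p" using assms unfolding preserving_iff by (rule spec)
    then have int: "fst ` E p \<inter> fst ` orth E p = {0}" using point.preserves_cotangent_iff_inter by blast
    moreover have sum: "UNIV = {x + y | x y. x \<in> fst ` E p \<and> y \<in> fst ` orth E p}"
      using point.sum_projections by blast
    ultimately show "direct_sum_decomposition UNIV (fst ` E p) (fst ` orth E p)"
      unfolding direct_sum_decomposition_def using point.subspace_projections by blast
    show F: "dim (fst ` E p) = r" using pc by (simp add: point.preserves_cotangent_iff_dim[OF refl])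
    have "dim (UNIV :: 'e set) = card \<B>"
      using dim_span_eq_card_independent[OF independent_basis] span_basis by simp
    then show "dim (fst ` orth E p) = card \<B> - r"
      using subspace_dim_sum[OF finite_basis span_basis point.subspace_projections int] sum F by simp
    show "\<And>v. v \<in> fst ` E p \<Longrightarrow> fst (pr E p (v, 0)) = v"
      "\<And>v. v \<in> fst ` orth E p \<Longrightarrow> fst (pr E p (v, 0)) = 0"
      using point.fst_pr_vector[OF pc] by blast+
    show "fst (pr E p (v, 0)) \<in> fst ` E p" "v - fst (pr E p (v, 0)) \<in> fst ` orth E p" for v
      using point.pr_mem[of p "(v, 0)"] point.pr_diff_mem[of "(v, 0)" p] by (force simp: image_iff)+
    show "linear (\<lambda>v. fst (pr E p (v, 0)))"
      using linear_compose[OF point.linear_pr_vector linear_fst] by (simp add: o_def)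
  qed
  \<comment> \<open>The coordinate fields form the image of the basis under a surjective linear map
    at each point, so applying h to them spans the whole range of h.\<close>
  have range_span: "span ((\<lambda>b. h (from_coords A c q b)) ` \<B>) = range h"
    if h: "linear h" and c: "c \<in> A" "q \<in> fst c" for h :: "'e \<Rightarrow> 'e" and c q
  proof -
    have "linear (\<lambda>w. h (from_coords A c q w))"
      using linear_compose[OF linear_coords(2)[OF c] h] by (simp add: o_def)
    then have "span ((\<lambda>b. h (from_coords A c q b)) ` \<B>) = (\<lambda>w. h (from_coords A c q w)) ` UNIV"
      using linear_span_image[of "\<lambda>w. h (from_coords A c q w)" \<B>] by (simp add: span_basis)
    also have "\<dots> = range h"
    proof (intro subset_antisym image_subsetI)
      show "h w \<in> range (\<lambda>w. h (from_coords A c q w))" for w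
        by (rule range_eqI[of _ _ "to_coords A c q w"]) (simp add: from_to_coords[OF c])
    qed simp
    finally show ?thesis .
  qed
  \<comment> \<open>The neighbourhood given by \<open>smooth_projection\<close> depends on the
    field; as the basis is finite, a common one is obtained by intersection.\<close>
  have smooth: "\<exists>W. open W \<and> p \<in> W \<and> W \<subseteq> fst c \<and>
      (\<forall>b\<in>\<B>. smooth_vector_field_on A W (\<lambda>q. fst (pr E q (from_coords A c q b, 0))))"
    if c: "c \<in> A" "p \<in> fst c" for c p
  proof -
    have "\<forall>b. \<exists>W. open W \<and> p \<in> W \<and> W \<subseteq> fst c \<and>
        smooth_vector_field_on A W (\<lambda>q. fst (pr E q (from_coords A c q b, 0)))"
      using smooth_projection[OF open_domain[OF c(1)] smooth_coordinate_field[OF c(1)] c(2)] by blast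
    from choice[OF this] obtain W where W: "open (W b)" "p \<in> W b"  "W b \<subseteq> fst c"
      "smooth_vector_field_on A (W b) (\<lambda>q. fst (pr E q (from_coords A c q b, 0)))" for b by blast
    have "smooth_vector_field_on A (fst c \<inter> (\<Inter>b\<in>\<B>. W b)) (\<lambda>q. fst (pr E q (from_coords A c q b, 0)))"
      if "b \<in> \<B>" for b
      by (rule smooth_vector_field_on_subset[OF W(4)[of b]]) (use that in blast)
    then show ?thesis
      using W c finite_basis open_domain[OF c(1)]
      by (intro exI[of _ "fst c \<inter> (\<Inter>b\<in>\<B>. W b)"] conjI ballI open_Int open_INT) auto
  qed
  have "tangent_subbundle A (\<lambda>p. fst ` E p)"
  proof (rule tangent_subbundle_if_spanned[OF _ decomp(2)])
    show "subspace (fst ` E p)" for p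
      using decomp(1) by (simp add: direct_sum_decomposition_def)
    fix p
    obtain c where c: "c \<in> A" "p \<in> fst c" using charts_cover by blast
    obtain W where W: "open W" "p \<in> W" "W \<subseteq> fst c"
      "\<And>b. b \<in> \<B> \<Longrightarrow> smooth_vector_field_on A W (\<lambda>q. fst (pr E q (from_coords A c q b, 0)))"
      using smooth[OF c] by blast
    have "range (\<lambda>v. fst (pr E q (v, 0))) = fst ` E q" for q
      using decomp(4,6) by (metis (no_types, lifting) image_subsetI rangeI subsetI subset_antisym)
    then have "span ((\<lambda>b. fst (pr E q (from_coords A c q b, 0))) ` \<B>) = fst ` E q" if "q \<in> W" for q
      using range_span[OF decomp(8) c(1)] W(3) that by blast
    then show "\<exists>W. open W \<and> p \<in> W \<and> (\<exists>X. (\<forall>b\<in>\<B>. smooth_vector_field_on A W (X b)) \<and>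
        (\<forall>q\<in>W. span ((\<lambda>b. X b q) ` \<B>) = fst ` E q))"
      using W by (intro exI[of _ W] conjI exI[of _ "\<lambda>b q. fst (pr E q (from_coords A c q b, 0))"]) auto
  qed
  moreover have "tangent_subbundle A (\<lambda>p. fst ` orth E p)"
  proof (rule tangent_subbundle_if_spanned[OF _ decomp(3)])
    show "subspace (fst ` orth E p)" for p
      using decomp(1) by (simp add: direct_sum_decomposition_def)
    fix p
    obtain c where c: "c \<in> A" "p \<in> fst c" using charts_cover by blast
    obtain W where W: "open W" "p \<in> W" "W \<subseteq> fst c"
      "\<And>b. b \<in> \<B> \<Longrightarrow> smooth_vector_field_on A W (\<lambda>q. fst (pr E q (from_coords A c q b, 0)))"
      using smooth[OF c] by blast
    let ?X = "\<lambda>b q. from_coords A c q b - fst (pr E q (from_coords A c q b, 0))"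
    have "smooth_vector_field_on A W (?X b)" if b: "b \<in> \<B>" for b
    proof -
      \<comment> \<open>The difference of two fields is written as a combination over a two-element
        index set, with coefficients 1 and -1.\<close>
      have "smooth_vector_field_on A W (\<lambda>q. if i then from_coords A c q b
          else fst (pr E q (from_coords A c q b, 0)))" for i
        by (cases i) (simp_all add: W(4)[OF b]
            smooth_vector_field_on_subset[OF smooth_coordinate_field[OF c(1)] W(3)])
      then have "smooth_vector_field_on A W (\<lambda>q. \<Sum>i\<in>{True, False}. (if i then 1 else - 1) *\<^sub>R
          (if i then from_coords A c q b else fst (pr E q (from_coords A c q b, 0))))"
        by (intro smooth_vector_field_on_linear_combination[OF W(1)] smooth_fun_const)
      then show ?thesis by simp
    qed
    moreover have "range (\<lambda>v. v - fst (pr E q (v, 0))) = fst ` orth E q" for q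
    proof (intro subset_antisym subsetI)
      fix v assume "v \<in> fst ` orth E q"
      then have "v = v - fst (pr E q (v, 0))" using decomp(5) by simp
      then show "v \<in> range (\<lambda>v. v - fst (pr E q (v, 0)))" by blast
    qed (use decomp(7) in blast)
    then have "span ((\<lambda>b. ?X b q) ` \<B>) = fst ` orth E q" if "q \<in> W" for q
      using range_span[OF linear_compose_sub[OF linear_ident decomp(8)] c(1)] W(3) that by blast
    ultimately show "\<exists>W. open W \<and> p \<in> W \<and> (\<exists>X. (\<forall>b\<in>\<B>. smooth_vector_field_on A W (X b)) \<and>
        (\<forall>q\<in>W. span ((\<lambda>b. X b q) ` \<B>) = fst ` orth E q))"
      using W by (intro exI[of _ W] conjI exI[of _ ?X]) auto
  qed
  ultimately show ?thesis using decomp(1) by (simp add: almost_product_structure_def)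
qed

lemma preserving_if_almost_product:
  assumes "almost_product_structure A (\<lambda>p. fst ` E p) (\<lambda>p. fst ` orth E p)"
  shows preserving
  unfolding preserving_iff
proof
  fix p
  show "point.preserves_cotangent p"
    using assms
    by (simp add: point.preserves_cotangent_iff_inter almost_product_structure_def direct_sum_decomposition_def)
qed

lemma preserving_iff_Ad:
  "preserving \<longleftrightarrow> (\<exists>B. smooth_form_of_degree A 2 B \<and>
    (\<forall>p. Ad_image (B p) (E p) = fst ` E p \<times> annihilator (fst ` orth E p) \<and>
         Ad_image (B p) (orth E p) = fst ` orth E p \<times> annihilator (fst ` E p)))"
proof
  assume preserving
  then show "\<exists>B. smooth_form_of_degree A 2 B \<and>
    (\<forall>p. Ad_image (B p) (E p) = fst ` E p \<times> annihilator (fst ` orth E p) \<and>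
         Ad_image (B p) (orth E p) = fst ` orth E p \<times> annihilator (fst ` E p))"
    using smooth_split_form point.Ad_image_split_form
    by (intro exI[of _ "split_form E"]) (simp add: preserving_iff)
next
  assume "\<exists>B. smooth_form_of_degree A 2 B \<and>
    (\<forall>p. Ad_image (B p) (E p) = fst ` E p \<times> annihilator (fst ` orth E p) \<and>
         Ad_image (B p) (orth E p) = fst ` orth E p \<times> annihilator (fst ` E p))"
  then obtain B where B: "smooth_form_of_degree A 2 B"
    "Ad_image (B p) (E p) = fst ` E p \<times> annihilator (fst ` orth E p)"
    "Ad_image (B p) (orth E p) = fst ` orth E p \<times> annihilator (fst ` E p)" for p
    by auto
  have "B p \<in> forms_of_degree 2" for p
    using B(1) by (simp add: smooth_form_of_degree_def)
  then show preserving
    unfolding preserving_iff by (intro allI point.preserves_cotangent_if_Ad_image[OF _ B(2,3)])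
qed

lemma preserving_iff_isotropic:
  "preserving \<longleftrightarrow> (\<forall>f g. smooth_function A f \<longrightarrow> smooth_function A g \<longrightarrow>
    (\<forall>p. gbracket (pr E p (0, differential A f p)) (pr E p (0, differential A g p)) = 0))"
proof -
  have "preserving \<longleftrightarrow> (\<forall>p \<alpha> \<beta>. gbracket (pr E p (0, \<alpha>)) (pr E p (0, \<beta>)) = 0)"
    by (simp only: preserving_iff point.preserves_cotangent_iff_isotropic)
  moreover have "gbracket (pr E p (0, \<alpha>)) (pr E p (0, \<beta>)) = 0"
    if *: "\<forall>f g. smooth_function A f \<longrightarrow> smooth_function A g \<longrightarrow>
      (\<forall>p. gbracket (pr E p (0, differential A f p)) (pr E p (0, differential A g p)) = 0)" for p \<alpha> \<beta>
  proof -
    obtain f g where "smooth_function A f" "differential A f p = \<alpha>"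
      "smooth_function A g" "differential A g p = \<beta>"
      using differential_surjective[of p \<alpha>] differential_surjective[of p \<beta>] by blast
    then show ?thesis using * by blast
  qed
  ultimately show ?thesis by blast
qed

end

theorem proposition26:
  fixes A :: "('m::{t2_space, second_countable_topology}, 'e::real_inner) chart set"
    and E :: "'m \<Rightarrow> 'e gvector set" and r :: nat
  assumes "smooth_manifold A" and "connected (UNIV :: 'm set)"
    and "split_structure A r E"
  shows
    "(generalized_almost_product_structure A E \<longleftrightarrow>
       (\<forall>p. direct_sum_decomposition cotangent (cotangent \<inter> E p) (cotangent \<inter> orth E p)))
     \<and>
     (generalized_almost_product_structure A E \<longleftrightarrow>
       almost_product_structure A (\<lambda>p. fst ` E p) (\<lambda>p. fst ` orth E p))
     \<and>
     (generalized_almost_product_structure A E \<longleftrightarrow>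
       (\<exists>B. smooth_form_of_degree A 2 B \<and>
          (\<forall>p. Ad_image (B p) (E p) = fst ` E p \<times> annihilator (fst ` orth E p) \<and>
               Ad_image (B p) (orth E p) = fst ` orth E p \<times> annihilator (fst ` E p))))
     \<and>
     (generalized_almost_product_structure A E \<longleftrightarrow>
       (\<forall>f g. smooth_function A f \<longrightarrow> smooth_function A g \<longrightarrow>
          (\<forall>p. gbracket (pr E p (0, differential A f p)) (pr E p (0, differential A g p)) = 0)))"
proof -
  have "\<exists>B::'e set. finite B \<and> span B = UNIV"
    using assms(1) by (simp add: smooth_manifold_def)
  then obtain \<B> :: "'e set" where "orthonormal_basis \<B>" using orthonormal_basis_exists by blast
  then interpret split_mfd \<B> A E r
    by (intro split_mfd.intro smooth_mfd.intro smooth_mfd_axioms.intro split_mfd_axioms.intro assms)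
  show ?thesis
    using gap_iff_preserving preserving_iff_decomposition almost_product_if_preserving
      preserving_if_almost_product preserving_iff_Ad preserving_iff_isotropic by blast
qed

end
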